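(* Let $L_1,L_2>0$ and let $u:[0,L_2)\to\mathbb{R}$ be smooth and $L_2$-periodic. Assume that there exist $m,N\in\mathbb{N}$, $c_1>0$ and $\delta_0\in(0,L_2)$ with the property that, for any $\lambda\in\mathbb{R}$ and any $\delta\in(0,\delta_0)$, there exist $n\le N$ and points $y_1,\dots,y_n\in[0,L_2)$ such that $$|u(y)-\lambda|\ge c_1\Big(\frac{\delta}{L_2}\Big)^m\qquad\text{for all } y \text{ with } |y-y_j|\ge\delta \text{ for every } j\in\{1,\dots,n\}.$$ Then there exists a constant $\varepsilon_0'>0$, independent of $\nu$ and $k$, such that for all $\nu\in(0,1]$ and all $k\neq 0$ with $\frac{L_1k}{2\pi}\in\mathbb{Z}$ and $\nu|k|^{-1}\le 1$, $$\Psi(H_{\nu,k})\ge\varepsilon_0'\,\nu^{\frac{m}{m+4}}|k|^{\frac{4}{m+4}}.$$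
   Context: $\mathbb{T}^1=[0,L_2)$ with periodic boundary conditions; $|y-y_j|$ is the distance on this circle. $\|\cdot\|$ is the norm of the complex-valued space $L^2(\mathbb{T}^1)$. For $k$ and $\nu$ as in the claim, $$H_{\nu,k}=\nu\Delta_k^2+iku(y),\qquad \Delta_k=-k^2+\partial_{yy},$$ is an operator on $L^2(\mathbb{T}^1)$ with domain $D(H_{\nu,k})=H^4(\mathbb{T}^1)$. For a closed densely defined operator $H$ on a complex Hilbert space, $$\Psi(H)=\inf\{\|(H-i\lambda)g\|:\ g\in D(H),\ \lambda\in\mathbb{R},\ \|g\|=1\}.$$ *)

theory Defs
  imports "HOL-Analysis.Analysis"
begin

definition smooth_periodic :: "real \<Rightarrow> (real \<Rightarrow> real) \<Rightarrow> bool" where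
  "smooth_periodic L f \<longleftrightarrow>
     (\<forall>n x. (deriv ^^ n) f differentiable (at x)) \<and> (\<forall>x. f (x + L) = f x)"

definition circle_dist :: "real \<Rightarrow> real \<Rightarrow> real \<Rightarrow> real" where
  "circle_dist L x y = (INF n::int. \<bar>x - y + of_int n * L\<bar>)"

(* Elements of the complex Hilbert space on the circle of length L are handled through
   representatives: only the values on {0..<L} matter, and circle_norm L is a seminorm
   whose null space is the set of functions vanishing almost everywhere on {0..<L}. *)
definition circle_L2 :: "real \<Rightarrow> (real \<Rightarrow> complex) set" where
  "circle_L2 L = {g. g \<in> borel_measurable (lebesgue_on {0..<L}) \<and>
                     integrable (lebesgue_on {0..<L}) (\<lambda>y. (cmod (g y))\<^sup>2)}"

definition circle_norm :: "real \<Rightarrow> (real \<Rightarrow> complex) \<Rightarrow> real" where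
  "circle_norm L g = sqrt (\<integral>y. (cmod (g y))\<^sup>2 \<partial>lebesgue_on {0..<L})"

(* Since the test functions are periodic, no boundary terms appear and the periodic
   boundary conditions are built in.  Real-valued test functions suffice by linearity. *)
definition has_weak_deriv ::
  "real \<Rightarrow> nat \<Rightarrow> (real \<Rightarrow> complex) \<Rightarrow> (real \<Rightarrow> complex) \<Rightarrow> bool" where
  "has_weak_deriv L j g h \<longleftrightarrow> g \<in> circle_L2 L \<and> h \<in> circle_L2 L \<and>
     (\<forall>\<phi>. smooth_periodic L \<phi> \<longrightarrow>
        (\<integral>y. g y * complex_of_real ((deriv ^^ j) \<phi> y) \<partial>lebesgue_on {0..<L}) =
        (-1) ^ j * (\<integral>y. h y * complex_of_real (\<phi> y) \<partial>lebesgue_on {0..<L}))"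

definition circle_sobolev :: "real \<Rightarrow> nat \<Rightarrow> (real \<Rightarrow> complex) set" where
  "circle_sobolev L s = {g \<in> circle_L2 L. \<forall>j\<in>{1..s}. \<exists>h. has_weak_deriv L j g h}"

(* A weak derivative is unique up to a null set, so the choice of representative
   affects neither norms nor further weak derivatives. *)
definition weak_deriv :: "real \<Rightarrow> nat \<Rightarrow> (real \<Rightarrow> complex) \<Rightarrow> real \<Rightarrow> complex" where
  "weak_deriv L j g = (SOME h. has_weak_deriv L j g h)"

definition laplace_k :: "real \<Rightarrow> real \<Rightarrow> (real \<Rightarrow> complex) \<Rightarrow> real \<Rightarrow> complex" where
  "laplace_k L k g = (\<lambda>y. - (complex_of_real k)\<^sup>2 * g y + weak_deriv L 2 g y)"

definition H_op ::
  "real \<Rightarrow> (real \<Rightarrow> real) \<Rightarrow> real \<Rightarrow> real \<Rightarrow> (real \<Rightarrow> complex) \<Rightarrow> real \<Rightarrow> complex" where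
  "H_op L u \<nu> k g =
     (\<lambda>y. complex_of_real \<nu> * laplace_k L k (laplace_k L k g) y
          + \<i> * complex_of_real k * complex_of_real (u y) * g y)"

(* D is the domain of the operator H on the Hilbert space over the circle of length L. *)
definition Psi ::
  "real \<Rightarrow> (real \<Rightarrow> complex) set \<Rightarrow> ((real \<Rightarrow> complex) \<Rightarrow> real \<Rightarrow> complex) \<Rightarrow> real" where
  "Psi L D H =
     Inf {circle_norm L (\<lambda>y. H g y - \<i> * complex_of_real lam * g y) | g lam.
            g \<in> D \<and> circle_norm L g = 1}"

end

theory Submission
  imports Defs
begin

text \<open>
  Write \<open>H g - i \<lambda> g = \<nu> \<Delta>\<^sub>k\<^sup>2 g + i k (u - l) g =: F\<close> with \<open>l = \<lambda> / k\<close>, put \<open>r = (\<nu> / |k|)\<^bsup>1/(m+4)\<^esup>\<close> and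
  \<open>T = |k| r\<^sup>m = \<nu> / r\<^sup>4\<close>, which is the claimed rate, and suppose that \<open>\<parallel>F\<parallel> < e\<^sup>4 T \<parallel>g\<parallel>\<close>.
  Testing \<open>F\<close> with \<open>g\<close> gives \<open>\<parallel>\<Delta>\<^sub>k g\<parallel> \<lesssim> e\<^sup>2 \<parallel>g\<parallel> / r\<^sup>2\<close> and, by interpolation, \<open>\<parallel>g'\<parallel> \<lesssim> e \<parallel>g\<parallel> / r\<close>.
  Testing with \<open>\<eta> g\<close>, where \<open>\<eta>\<close> is a smoothed \<open>sgn (u - l)\<close> that vanishes within distance
  \<open>\<delta> = \<kappa> r\<close> of the points \<open>y\<^sub>j\<close>, the imaginary part controls \<open>|k| \<delta>\<^sup>m \<integral>|\<eta>| |g|\<^sup>2\<close> up to commutator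
  terms that the previous bounds absorb. On the remaining set, of measure \<open>\<lesssim> N \<delta>\<close>, the mass of \<open>g\<close> is small
  by \<open>sup |g|\<^sup>2 \<le> \<parallel>g\<parallel>\<^sup>2 / L + 2 \<parallel>g\<parallel> \<parallel>g'\<parallel>\<close>. For small \<open>\<kappa>\<close> and then small \<open>e\<close> this is contradictory.
  The argument needs classical derivatives; it is applied to the Fourier partial sums of \<open>g \<in> H\<^sup>4\<close>, for
  which \<open>\<Delta>\<^sub>k\<^sup>2\<close> of the partial sum is the partial sum of the weak \<open>\<Delta>\<^sub>k\<^sup>2 g\<close> and hence converges in \<open>L\<^sup>2\<close>.
\<close>

section \<open>The Hilbert space on the circle\<close>

text \<open>The length r balances diffusion over a distance r, of size \<nu> / r^4, against |k| r^m,
  the size that |k (u - l)| is known to reach at distance about r from the points. The condition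
  \<nu> / |k| \<le> 1 gives r \<le> 1 and so keeps \<delta> below \<open>\<delta>0\<close>. The
  threshold is e^4 because each energy step takes a square root: e^2 remains for
  \<open>\<Delta>\<^sub>k\<close> g and e for g'. Every commutator term carries the factor
  \<open>\<Delta>\<^sub>k\<close> g, hence e^2. This fixes the order of choice: \<kappa> comes from
  the mass estimate near the points alone, and e may then depend on 1 / \<kappa> and 1 / \<kappa>^2.
  The obstacle is the regularity of \<eta>: moving one Laplacian onto \<eta> g differentiates \<eta>
  twice, and the bounds have to be of order 1 / \<delta> and 1 / \<delta>^2, uniformly in l.
  Smoothing the sign through the values of u would bring in derivatives of u. So the sign is kept as
  it is and multiplied by a function of the bumps alone, which vanishes near every sign
  change.\<close>

abbreviation circle_measure :: "real \<Rightarrow> real measure" where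
  "circle_measure L \<equiv> lebesgue_on {0..<L}"

lemma space_circle [simp]: "space (circle_measure L) = {0..<L}"
  by (simp add: space_restrict_space)

lemma integrable_continuous_circle:
  fixes f :: "real \<Rightarrow> 'a::euclidean_space"
  assumes "continuous_on UNIV f"
  shows "integrable (circle_measure L) f"
proof -
  have "f absolutely_integrable_on {0..L}"
    using assms continuous_on_subset by (intro absolutely_integrable_continuous_real) blast
  then have "f absolutely_integrable_on {0..<L}"
    by (rule set_integrable_subset) auto
  then show ?thesis
    by (simp add: integrable_restrict_space set_integrable_def)
qed

lemma measurable_continuous_circle [measurable]:
  fixes f :: "real \<Rightarrow> 'a::euclidean_space"
  assumes "continuous_on UNIV f"
  shows "f \<in> borel_measurable (circle_measure L)"
  using integrable_continuous_circle[OF assms] by (rule borel_measurable_integrable)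

lemma integral_circle_eq:
  fixes f :: "real \<Rightarrow> 'a::euclidean_space"
  assumes "continuous_on UNIV f"
  shows "(\<integral>y. f y \<partial>circle_measure L) = integral {0..L} f"
proof -
  have "(\<integral>y. f y \<partial>circle_measure L) = integral {0..<L} f"
    using integrable_continuous_circle[OF assms] by (intro lebesgue_integral_eq_integral) auto
  also have "\<dots> = integral {0..L} f"
  proof (rule integral_spike_set)
    show "negligible {x \<in> {0..<L} - {0..L}. f x \<noteq> 0}"
      by (rule negligible_subset[of "{}"]) auto
    show "negligible {x \<in> {0..L} - {0..<L}. f x \<noteq> 0}"
      by (rule negligible_subset[of "{L}"]) auto
  qed
  finally show ?thesis .
qed

text \<open>Periodicity of \<open>f\<close> is deliberately not assumed: for the bumps the
  antiderivative grows over one period, and this growth is the integral.\<close>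

lemma integral_circle_deriv:
  fixes f :: "real \<Rightarrow> 'a::euclidean_space"
  assumes "L \<ge> 0" and "\<And>x. (f has_vector_derivative f' x) (at x)" and "continuous_on UNIV f'"
  shows "(\<integral>y. f' y \<partial>circle_measure L) = f L - f 0"
proof -
  have "(f' has_integral (f L - f 0)) {0..L}"
    using assms by (intro fundamental_theorem_of_calculus)
      (auto intro: has_vector_derivative_at_within)
  then show ?thesis
    by (simp add: integral_circle_eq[OF assms(3)] integral_unique)
qed

lemma integral_circle_by_parts:
  fixes f h :: "real \<Rightarrow> complex"
  assumes "L \<ge> 0"
    and f: "\<And>x. (f has_vector_derivative f' x) (at x)" "continuous_on UNIV f'" "f L = f 0"
    and h: "\<And>x. (h has_vector_derivative h' x) (at x)" "continuous_on UNIV h'" "h L = h 0"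
  shows "(\<integral>y. f y * h' y \<partial>circle_measure L) = - (\<integral>y. f' y * h y \<partial>circle_measure L)"
proof -
  have cf: "continuous_on UNIV f" and ch: "continuous_on UNIV h"
    using f(1) h(1) by (meson continuous_at_imp_continuous_on has_vector_derivative_continuous)+
  have "(\<integral>y. f y * h' y + f' y * h y \<partial>circle_measure L) = f L * h L - f 0 * h 0"
    by (rule integral_circle_deriv[OF assms(1)])
      (auto intro!: has_vector_derivative_mult f h continuous_intros cf ch)
  moreover have "(\<integral>y. f y * h' y + f' y * h y \<partial>circle_measure L) =
      (\<integral>y. f y * h' y \<partial>circle_measure L) + (\<integral>y. f' y * h y \<partial>circle_measure L)"
    by (intro Bochner_Integration.integral_add integrable_continuous_circle continuous_intros f h cf ch)
  ultimately show ?thesis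
    using f h by (simp add: eq_neg_iff_add_eq_0)
qed

lemma circle_L2_measurable: "g \<in> circle_L2 L \<Longrightarrow> g \<in> borel_measurable (circle_measure L)"
  by (simp add: circle_L2_def)

lemma circle_L2_integrable:
  "g \<in> circle_L2 L \<Longrightarrow> integrable (circle_measure L) (\<lambda>y. (cmod (g y))\<^sup>2)"
  by (simp add: circle_L2_def)

lemma circle_L2_continuous:
  assumes "continuous_on UNIV g"
  shows "g \<in> circle_L2 L"
  unfolding circle_L2_def using assms
  by (auto intro!: integrable_continuous_circle measurable_continuous_circle continuous_intros)

lemma circle_L2_add:
  assumes "f \<in> circle_L2 L" "g \<in> circle_L2 L"
  shows "(\<lambda>y. f y + g y) \<in> circle_L2 L"
proof -
  note [measurable] = assms[THEN circle_L2_measurable]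
  have "integrable (circle_measure L) (\<lambda>y. (cmod (f y + g y))\<^sup>2)"
  proof (rule Bochner_Integration.integrable_bound)
    show "integrable (circle_measure L) (\<lambda>y. 2 * (cmod (f y))\<^sup>2 + 2 * (cmod (g y))\<^sup>2)"
      using assms[THEN circle_L2_integrable] by simp
    have "(cmod (f y + g y))\<^sup>2 \<le> 2 * (cmod (f y))\<^sup>2 + 2 * (cmod (g y))\<^sup>2" for y
    proof -
      have "(cmod (f y + g y))\<^sup>2 \<le> (cmod (f y) + cmod (g y))\<^sup>2"
        by (intro power_mono norm_triangle_ineq) auto
      also have "\<dots> \<le> 2 * (cmod (f y))\<^sup>2 + 2 * (cmod (g y))\<^sup>2"
        using sum_squares_bound[of "cmod (f y)" "cmod (g y)"] by (simp add: power2_sum)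
      finally show ?thesis .
    qed
    then show "AE y in circle_measure L. norm ((cmod (f y + g y))\<^sup>2)
        \<le> norm (2 * (cmod (f y))\<^sup>2 + 2 * (cmod (g y))\<^sup>2)"
      by simp
  qed measurable
  then show ?thesis
    by (simp add: circle_L2_def)
qed

lemma circle_L2_mult_bounded:
  assumes "g \<in> circle_L2 L" and [measurable]: "b \<in> borel_measurable (circle_measure L)"
    and "\<And>y. y \<in> {0..<L} \<Longrightarrow> cmod (b y) \<le> C"
  shows "(\<lambda>y. b y * g y) \<in> circle_L2 L"
proof -
  note [measurable] = assms(1)[THEN circle_L2_measurable]
  have "integrable (circle_measure L) (\<lambda>y. (cmod (b y * g y))\<^sup>2)"
  proof (rule Bochner_Integration.integrable_bound)
    show "integrable (circle_measure L) (\<lambda>y. C\<^sup>2 * (cmod (g y))\<^sup>2)"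
      using assms(1)[THEN circle_L2_integrable] by simp
    show "AE y in circle_measure L. norm ((cmod (b y * g y))\<^sup>2) \<le> norm (C\<^sup>2 * (cmod (g y))\<^sup>2)"
      using assms(3) by (intro AE_I2) (auto simp: norm_mult power_mult_distrib intro!: mult_right_mono power_mono)
  qed measurable
  then show ?thesis
    by (simp add: circle_L2_def)
qed

lemma circle_L2_cmult: "g \<in> circle_L2 L \<Longrightarrow> (\<lambda>y. c * g y) \<in> circle_L2 L"
  by (rule circle_L2_mult_bounded[where C = "cmod c"]) auto

lemma circle_L2_diff:
  "f \<in> circle_L2 L \<Longrightarrow> g \<in> circle_L2 L \<Longrightarrow> (\<lambda>y. f y - g y) \<in> circle_L2 L"
  using circle_L2_add[of f L "\<lambda>y. (-1) * g y"] circle_L2_cmult[of g L "-1"] by simp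

lemma circle_L2_mult_continuous:
  assumes "g \<in> circle_L2 L" "continuous_on UNIV b"
  shows "(\<lambda>y. b y * g y) \<in> circle_L2 L"
proof -
  have "compact (b ` {0..L})"
    using assms(2) by (intro compact_continuous_image) (auto intro: continuous_on_subset)
  then have "bounded (b ` {0..L})"
    by (rule compact_imp_bounded)
  then obtain C where C: "\<forall>z\<in>b ` {0..L}. cmod z \<le> C"
    unfolding bounded_iff by blast
  have "b \<in> borel_measurable (circle_measure L)"
    using assms(2) by (rule measurable_continuous_circle)
  with assms(1) show ?thesis
    by (rule circle_L2_mult_bounded[where C = C]) (use C in auto)
qed

lemma circle_norm_nonneg [simp]: "circle_norm L g \<ge> 0"
  by (simp add: circle_norm_def)

lemma circle_norm_power2: "(circle_norm L g)\<^sup>2 = (\<integral>y. (cmod (g y))\<^sup>2 \<partial>circle_measure L)"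
  by (simp add: circle_norm_def)

lemma circle_L2_mult_integrable:
  assumes "f \<in> circle_L2 L" "g \<in> circle_L2 L"
  shows "integrable (circle_measure L) (\<lambda>y. f y * g y)"
proof (rule Bochner_Integration.integrable_bound)
  note [measurable] = assms[THEN circle_L2_measurable]
  show "(\<lambda>y. f y * g y) \<in> borel_measurable (circle_measure L)"
    by measurable
  show "integrable (circle_measure L) (\<lambda>y. (cmod (f y))\<^sup>2 + (cmod (g y))\<^sup>2)"
    using assms[THEN circle_L2_integrable] by simp
  have "cmod (f y * g y) \<le> (cmod (f y))\<^sup>2 + (cmod (g y))\<^sup>2" for y
  proof -
    have "2 * (cmod (f y) * cmod (g y)) \<le> (cmod (f y))\<^sup>2 + (cmod (g y))\<^sup>2"
      using sum_squares_bound[of "cmod (f y)" "cmod (g y)"] by (simp add: mult.assoc)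
    moreover have "cmod (f y) * cmod (g y) \<ge> 0"
      by simp
    ultimately show ?thesis
      unfolding norm_mult by linarith
  qed
  then show "AE y in circle_measure L. norm (f y * g y) \<le> norm ((cmod (f y))\<^sup>2 + (cmod (g y))\<^sup>2)"
    by simp
qed

text \<open>The discriminant argument: the integral of (t |f| - |g|)^2 is a nonnegative quadratic in
  \<open>t\<close>. The modulus stands inside the integral because the triangle inequality and the
  bound on the oscillation of |g|^2 use this form. The optimal \<open>t\<close> is c / a^2, so a = 0
  is treated apart.\<close>

lemma circle_Cauchy_Schwarz_abs:
  assumes f: "f \<in> circle_L2 L" and g: "g \<in> circle_L2 L"
  shows "(\<integral>y. cmod (f y * g y) \<partial>circle_measure L) \<le> circle_norm L f * circle_norm L g"
proof -
  let ?M = "circle_measure L"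
  define a b c where "a = circle_norm L f" and "b = circle_norm L g"
    and "c = (\<integral>y. cmod (f y * g y) \<partial>?M)"
  have pos: "a \<ge> 0" "b \<ge> 0" "c \<ge> 0"
    by (simp_all add: a_def b_def c_def)
  have int: "integrable ?M (\<lambda>y. cmod (f y * g y))"
    using circle_L2_mult_integrable[OF f g] by simp
  have quad: "t\<^sup>2 * a\<^sup>2 - 2 * t * c + b\<^sup>2 \<ge> 0" for t
  proof -
    have "0 \<le> (\<integral>y. (t * cmod (f y) - cmod (g y))\<^sup>2 \<partial>?M)"
      by simp
    also have "\<dots> = (\<integral>y. t\<^sup>2 * (cmod (f y))\<^sup>2 - (2 * t) * cmod (f y * g y) + (cmod (g y))\<^sup>2 \<partial>?M)"
      by (intro Bochner_Integration.integral_cong refl) (simp add: power2_diff power_mult_distrib norm_mult)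
    also have "\<dots> = t\<^sup>2 * a\<^sup>2 - 2 * t * c + b\<^sup>2"
      unfolding a_def b_def c_def circle_norm_power2
      using int f[THEN circle_L2_integrable] g[THEN circle_L2_integrable]
      by (subst Bochner_Integration.integral_add Bochner_Integration.integral_diff | simp)+
    finally show ?thesis .
  qed
  have "c \<le> a * b"
  proof (cases "a = 0")
    case True
    show ?thesis
    proof (rule ccontr)
      assume "\<not> ?thesis"
      then have "c > 0"
        using True by simp
      \<comment> \<open>With a = 0 the quadratic degenerates to b^2 - 2 t c, and this
        \<open>t\<close> gives it the value -1.\<close>
      then have "2 * ((b\<^sup>2 + 1) / (2 * c)) * c = b\<^sup>2 + 1"
        by simp
      then show False
        using quad[of "(b\<^sup>2 + 1) / (2 * c)"] True by simp
    qed
  next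
    case False
    then have "a > 0"
      using pos by simp
    then have "(c / a\<^sup>2)\<^sup>2 * a\<^sup>2 - 2 * (c / a\<^sup>2) * c + b\<^sup>2 = b\<^sup>2 - c\<^sup>2 / a\<^sup>2"
      by (simp add: power2_eq_square)
    then have "c\<^sup>2 / a\<^sup>2 \<le> b\<^sup>2"
      using quad[of "c / a\<^sup>2"] by linarith
    then have "c\<^sup>2 \<le> (a * b)\<^sup>2"
      using \<open>a > 0\<close> by (simp add: pos_divide_le_eq power_mult_distrib mult.commute)
    then show ?thesis
      using pos by (intro power2_le_imp_le[of c "a * b"]) auto
  qed
  then show ?thesis
    unfolding a_def b_def c_def .
qed

lemma circle_Cauchy_Schwarz:
  assumes f: "f \<in> circle_L2 L" and g: "g \<in> circle_L2 L"
  shows "cmod (\<integral>y. f y * g y \<partial>circle_measure L) \<le> circle_norm L f * circle_norm L g"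
  using circle_Cauchy_Schwarz_abs[OF f g]
    integral_norm_bound[of "circle_measure L" "\<lambda>y. f y * g y"] by linarith

lemma circle_norm_triangle:
  assumes f: "f \<in> circle_L2 L" and g: "g \<in> circle_L2 L"
  shows "circle_norm L (\<lambda>y. f y + g y) \<le> circle_norm L f + circle_norm L g"
proof (rule power2_le_imp_le)
  let ?M = "circle_measure L"
  have int: "integrable ?M (\<lambda>y. cmod (f y * g y))"
    using circle_L2_mult_integrable[OF f g] by simp
  note ints = int f[THEN circle_L2_integrable] g[THEN circle_L2_integrable]
  have "(circle_norm L (\<lambda>y. f y + g y))\<^sup>2 = (\<integral>y. (cmod (f y + g y))\<^sup>2 \<partial>?M)"
    by (rule circle_norm_power2)
  also have "\<dots> \<le> (\<integral>y. (cmod (f y))\<^sup>2 + (cmod (g y))\<^sup>2 + 2 * cmod (f y * g y) \<partial>?M)"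
  proof (rule integral_mono)
    show "integrable ?M (\<lambda>y. (cmod (f y + g y))\<^sup>2)"
      using circle_L2_add[OF f g] by (rule circle_L2_integrable)
    show "integrable ?M (\<lambda>y. (cmod (f y))\<^sup>2 + (cmod (g y))\<^sup>2 + 2 * cmod (f y * g y))"
      using ints by simp
    fix y
    have "(cmod (f y + g y))\<^sup>2 \<le> (cmod (f y) + cmod (g y))\<^sup>2"
      by (intro power_mono norm_triangle_ineq) auto
    then show "(cmod (f y + g y))\<^sup>2 \<le> (cmod (f y))\<^sup>2 + (cmod (g y))\<^sup>2 + 2 * cmod (f y * g y)"
      by (simp add: power2_sum norm_mult)
  qed
  also have "\<dots> = (circle_norm L f)\<^sup>2 + (circle_norm L g)\<^sup>2 + 2 * (\<integral>y. cmod (f y * g y) \<partial>?M)"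
    using ints by (simp add: circle_norm_power2)
  also have "\<dots> \<le> (circle_norm L f + circle_norm L g)\<^sup>2"
    using circle_Cauchy_Schwarz_abs[OF f g] by (simp add: power2_sum)
  finally show "(circle_norm L (\<lambda>y. f y + g y))\<^sup>2 \<le> (circle_norm L f + circle_norm L g)\<^sup>2" .
qed simp

lemma circle_norm_mult_bounded:
  assumes "g \<in> circle_L2 L" "b \<in> borel_measurable (circle_measure L)"
    and "\<And>y. y \<in> {0..<L} \<Longrightarrow> cmod (b y) \<le> C" "C \<ge> 0"
  shows "circle_norm L (\<lambda>y. b y * g y) \<le> C * circle_norm L g"
proof (rule power2_le_imp_le)
  have "(\<integral>y. (cmod (b y * g y))\<^sup>2 \<partial>circle_measure L) \<le> (\<integral>y. C\<^sup>2 * (cmod (g y))\<^sup>2 \<partial>circle_measure L)"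
    using assms circle_L2_integrable[OF circle_L2_mult_bounded[OF assms(1-3)]]
    by (intro integral_mono)
      (auto simp: norm_mult power_mult_distrib intro!: mult_right_mono power_mono circle_L2_integrable)
  then show "(circle_norm L (\<lambda>y. b y * g y))\<^sup>2 \<le> (C * circle_norm L g)\<^sup>2"
    by (simp add: circle_norm_power2 power_mult_distrib)
qed (use assms in simp)

lemma circle_norm_cmult: "circle_norm L (\<lambda>y. c * g y) = cmod c * circle_norm L g"
  by (simp add: circle_norm_def norm_mult power_mult_distrib real_sqrt_mult)

lemma circle_norm_diff_commute: "circle_norm L (\<lambda>y. f y - g y) = circle_norm L (\<lambda>y. g y - f y)"
  by (simp add: circle_norm_def norm_minus_commute)

section \<open>The cutoff function\<close>

text \<open>At 0 the difference quotient is at most |h|^(n - 1), which tends to 0 since n \<ge> 2.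
  This is the origin of the exponent 3 in the cutoff: two differentiations leave the first power of
  the positive part, which is still continuous.\<close>

lemma has_real_derivative_max_0_power:
  fixes t :: real
  assumes "n \<ge> 2"
  shows "((\<lambda>t. max 0 t ^ n) has_real_derivative (real n * max 0 t ^ (n - 1))) (at t)"
proof -
  consider "t > 0" | "t < 0" | "t = 0"
    by linarith
  then show ?thesis
  proof cases
    case 1
    have "((\<lambda>t. t ^ n) has_real_derivative (real n * max 0 t ^ (n - 1))) (at t)"
      using 1 by (auto intro!: derivative_eq_intros)
    then show ?thesis
      by (rule has_field_derivative_transform_within_open[of _ _ _ "{0<..}"]) (use 1 in auto)
  next
    case 2
    have "((\<lambda>t. 0) has_real_derivative (real n * max 0 t ^ (n - 1))) (at t)"
      using 2 assms by (auto intro!: derivative_eq_intros)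
    then show ?thesis
      by (rule has_field_derivative_transform_within_open[of _ _ _ "{..<0}"]) (use 2 assms in auto)
  next
    case 3
    have "(\<lambda>h. max 0 h ^ n / h) \<midarrow>0\<rightarrow> (0::real)"
    proof (rule Lim_null_comparison)
      have "norm (max 0 h ^ n / h) \<le> \<bar>h\<bar> ^ (n - 1)" if "h \<noteq> 0" for h :: real
      proof -
        obtain k where k: "n = Suc k"
          using assms by (cases n) auto
        show ?thesis
          using that assms unfolding k by (cases "h > 0") (auto simp: max_def power_abs)
      qed
      then show "\<forall>\<^sub>F h in at 0. norm (max 0 h ^ n / h) \<le> \<bar>h\<bar> ^ (n - 1)" for h :: real
        by (auto simp: eventually_at_filter)
      have "isCont (\<lambda>h::real. \<bar>h\<bar> ^ (n - 1)) 0"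
        by (intro continuous_intros)
      then show "(\<lambda>h::real. \<bar>h\<bar> ^ (n - 1)) \<midarrow>0\<rightarrow> 0"
        using assms by (simp add: isCont_def zero_power)
    qed
    then show ?thesis
      using 3 assms by (simp add: DERIV_def zero_power)
  qed
qed

section \<open>Differentiation of products with a sign\<close>

lemma eventually_sgn_eq:
  fixes v :: "real \<Rightarrow> real"
  assumes "isCont v y" "v y \<noteq> 0"
  shows "\<forall>\<^sub>F z in nhds y. sgn (v z) = sgn (v y)"
proof (cases "v y > 0")
  case True
  have "\<forall>\<^sub>F z in nhds y. v z > 0"
    using assms True by (simp add: isCont_def tendsto_at_iff_tendsto_nhds order_tendstoD)
  then show ?thesis
    by eventually_elim (use True in simp)
next
  case False
  then have neg: "v y < 0"
    using assms by simp
  then have "\<forall>\<^sub>F z in nhds y. v z < 0"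
    using assms by (simp add: isCont_def tendsto_at_iff_tendsto_nhds order_tendstoD)
  then show ?thesis
    by eventually_elim (use neg in simp)
qed

text \<open>Off the zeros of \<open>v\<close> the sign is locally constant, and near a zero the
  other factor vanishes. Either way the sign acts as a constant near \<open>y\<close>, so continuity
  and differentiability of \<open>f\<close> carry over and no derivative of \<open>v\<close>
  appears.\<close>

lemma eventually_sgn_mult_eq:
  fixes v f :: "real \<Rightarrow> real"
  assumes "isCont v y" "v y = 0 \<Longrightarrow> \<forall>\<^sub>F z in nhds y. f z = 0"
  shows "\<forall>\<^sub>F z in nhds y. sgn (v z) * f z = sgn (v y) * f z"
proof (cases "v y = 0")
  case True
  from assms(2)[OF True] show ?thesis
    by eventually_elim simp
next
  case False
  from eventually_sgn_eq[OF assms(1) False] show ?thesis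
    by eventually_elim simp
qed

lemma has_real_derivative_sgn_mult:
  fixes v f :: "real \<Rightarrow> real"
  assumes "isCont v y" "v y = 0 \<Longrightarrow> \<forall>\<^sub>F z in nhds y. f z = 0"
    and "(f has_real_derivative f') (at y)"
  shows "((\<lambda>z. sgn (v z) * f z) has_real_derivative (sgn (v y) * f')) (at y)"
  using DERIV_cong_ev[OF refl eventually_sgn_mult_eq[OF assms(1,2)] refl]
    DERIV_cmult[OF assms(3)] by blast

lemma isCont_sgn_mult:
  fixes v f :: "real \<Rightarrow> real"
  assumes "isCont v y" "v y = 0 \<Longrightarrow> \<forall>\<^sub>F z in nhds y. f z = 0" "isCont f y"
  shows "isCont (\<lambda>z. sgn (v z) * f z) y"
  using isCont_cong[OF eventually_sgn_mult_eq[OF assms(1,2)]] assms(3)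
  by (simp add: continuous_intros)

text \<open>Used with \<open>w = \<pi> / L\<close> and \<open>a = w \<delta>\<close>: an \<open>L\<close>-periodic bump at \<open>p\<close> that exceeds \<open>1\<close> within
  distance \<open>\<delta>\<close> of \<open>p\<close>. The primed versions are its derivatives.\<close>

definition circle_bump :: "real \<Rightarrow> real \<Rightarrow> real \<Rightarrow> real \<Rightarrow> real" where
  "circle_bump w a p y = 2 * a\<^sup>2 / ((sin (w * (y - p)))\<^sup>2 + a\<^sup>2)"

definition circle_bump' :: "real \<Rightarrow> real \<Rightarrow> real \<Rightarrow> real \<Rightarrow> real" where
  "circle_bump' w a p y = - 2 * a\<^sup>2 * (2 * w * sin (w * (y - p)) * cos (w * (y - p)))
     / ((sin (w * (y - p)))\<^sup>2 + a\<^sup>2)\<^sup>2"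

definition circle_bump'' :: "real \<Rightarrow> real \<Rightarrow> real \<Rightarrow> real \<Rightarrow> real" where
  "circle_bump'' w a p y = - 2 * a\<^sup>2 * (
     2 * w\<^sup>2 * ((cos (w * (y - p)))\<^sup>2 - (sin (w * (y - p)))\<^sup>2) / ((sin (w * (y - p)))\<^sup>2 + a\<^sup>2)\<^sup>2
     - 2 * (2 * w * sin (w * (y - p)) * cos (w * (y - p)))\<^sup>2 / ((sin (w * (y - p)))\<^sup>2 + a\<^sup>2) ^ 3)"

context
  fixes w a p :: real
  assumes a: "a > 0"
begin

lemma circle_bump_denominator: "(sin x)\<^sup>2 + a\<^sup>2 \<ge> a\<^sup>2" "(sin x)\<^sup>2 + a\<^sup>2 > 0" "(sin x)\<^sup>2 + a\<^sup>2 \<noteq> 0"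
proof -
  show "(sin x)\<^sup>2 + a\<^sup>2 \<ge> a\<^sup>2"
    by simp
  show "(sin x)\<^sup>2 + a\<^sup>2 > 0"
    using a by (simp add: add_nonneg_pos)
  then show "(sin x)\<^sup>2 + a\<^sup>2 \<noteq> 0"
    by (rule less_imp_neq[symmetric])
qed

lemma circle_bump_deriv:
  "(circle_bump w a p has_real_derivative circle_bump' w a p y) (at y)"
  unfolding circle_bump_def[abs_def] circle_bump'_def
  using circle_bump_denominator[of "w * (y - p)"]
  by (auto intro!: derivative_eq_intros simp: power2_eq_square)

lemma circle_bump'_deriv:
  "(circle_bump' w a p has_real_derivative circle_bump'' w a p y) (at y)"
proof -
  define D where "D = (\<lambda>y. (sin (w * (y - p)))\<^sup>2 + a\<^sup>2)"
  define s1 where "s1 = (\<lambda>y. 2 * w * sin (w * (y - p)) * cos (w * (y - p)))"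
  define s2 where "s2 = 2 * w\<^sup>2 * ((cos (w * (y - p)))\<^sup>2 - (sin (w * (y - p)))\<^sup>2)"
  have D: "(D has_real_derivative s1 y) (at y)"
    unfolding D_def s1_def by (auto intro!: derivative_eq_intros)
  have s1: "(s1 has_real_derivative s2) (at y)"
    unfolding s1_def s2_def
    by (auto intro!: derivative_eq_intros simp: power2_eq_square algebra_simps)
  have nz: "D y \<noteq> 0"
    using circle_bump_denominator(3) by (simp add: D_def)
  have "((\<lambda>y. - 2 * a\<^sup>2 * s1 y / (D y)\<^sup>2) has_real_derivative
      - 2 * a\<^sup>2 * (s2 / (D y)\<^sup>2 - 2 * (s1 y)\<^sup>2 / D y ^ 3)) (at y)"
    using nz by (auto intro!: derivative_eq_intros D s1)
      (simp add: field_simps power2_eq_square power3_eq_cube power4_eq_xxxx)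
  then show ?thesis
    unfolding circle_bump'_def[abs_def] circle_bump''_def D_def s1_def s2_def .
qed

lemma isCont_circle_bump'': "isCont (circle_bump'' w a p) y"
  unfolding circle_bump''_def[abs_def]
  using circle_bump_denominator[of "w * (y - p)"]
  by (intro continuous_intros) auto

lemma circle_bump_nonneg: "circle_bump w a p y \<ge> 0"
  unfolding circle_bump_def by simp

lemma circle_bump_gt_1: "\<bar>sin (w * (y - p))\<bar> < a \<Longrightarrow> circle_bump w a p y > 1"
proof -
  assume "\<bar>sin (w * (y - p))\<bar> < a"
  then have "(sin (w * (y - p)))\<^sup>2 < a\<^sup>2"
    using a by (intro power2_strict_mono) auto
  then show ?thesis
    using circle_bump_denominator(2)[of "w * (y - p)"] by (simp add: circle_bump_def)
qed

text \<open>This trades a sine in the numerator for \<open>a\<close> times less of the denominator.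
  With it each derivative of the bump costs a factor of order w / a, which is 1 / \<delta> for a = w
  \<delta>; bounding the sine by 1 would cost w / a^2 in the first derivative.\<close>

lemma two_sin_mult_le: "2 * \<bar>sin x\<bar> * a \<le> (sin x)\<^sup>2 + a\<^sup>2"
  using sum_squares_bound[of "\<bar>sin x\<bar>" a] by simp

lemma abs_circle_bump'_le:
  assumes "w > 0"
  shows "\<bar>circle_bump' w a p y\<bar> \<le> 2 * w / a"
proof -
  define x where "x = w * (y - p)"
  define D where "D = (sin x)\<^sup>2 + a\<^sup>2"
  have D: "D > 0" "a\<^sup>2 \<le> D"
    using circle_bump_denominator[of x] by (auto simp: D_def)
  have "\<bar>circle_bump' w a p y\<bar> = (2 * a\<^sup>2 * w) * (2 * \<bar>sin x\<bar> * \<bar>cos x\<bar>) / D\<^sup>2"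
    using assms by (simp add: circle_bump'_def x_def D_def abs_mult)
  also have "\<dots> \<le> (2 * a\<^sup>2 * w) * (D / a) / D\<^sup>2"
  proof (intro divide_right_mono mult_left_mono)
    have "2 * \<bar>sin x\<bar> * \<bar>cos x\<bar> \<le> 2 * \<bar>sin x\<bar> * 1"
      by (intro mult_left_mono) auto
    also have "\<dots> \<le> D / a"
      using two_sin_mult_le[of x] a by (simp add: D_def field_simps)
    finally show "2 * \<bar>sin x\<bar> * \<bar>cos x\<bar> \<le> D / a" .
  qed (use assms in auto)
  also have "\<dots> = 2 * w * a / D"
    using a D by (simp add: field_simps power2_eq_square)
  also have "\<dots> \<le> 2 * w * a / a\<^sup>2"
    using a D assms by (intro divide_left_mono) auto
  also have "\<dots> = 2 * w / a"
    by (simp add: power2_eq_square)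
  finally show ?thesis .
qed

lemma abs_circle_bump''_le:
  assumes "w > 0"
  shows "\<bar>circle_bump'' w a p y\<bar> \<le> 8 * w\<^sup>2 / a\<^sup>2"
proof -
  define x where "x = w * (y - p)"
  define D where "D = (sin x)\<^sup>2 + a\<^sup>2"
  have D: "D > 0" "a\<^sup>2 \<le> D"
    using circle_bump_denominator[of x] by (auto simp: D_def)
  define s1 s2 where "s1 = 2 * w * sin x * cos x" and "s2 = 2 * w\<^sup>2 * ((cos x)\<^sup>2 - (sin x)\<^sup>2)"
  have s1: "s1\<^sup>2 \<le> (w * D / a)\<^sup>2"
  proof -
    have "2 * \<bar>sin x\<bar> * \<bar>cos x\<bar> \<le> 2 * \<bar>sin x\<bar> * 1"
      by (intro mult_left_mono) auto
    also have "\<dots> \<le> D / a"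
      using two_sin_mult_le[of x] a by (simp add: D_def field_simps)
    finally have "w * (2 * \<bar>sin x\<bar> * \<bar>cos x\<bar>) \<le> w * (D / a)"
      using assms by (intro mult_left_mono) auto
    then have "\<bar>s1\<bar> \<le> \<bar>w * D / a\<bar>"
      using assms a D by (simp add: s1_def abs_mult mult_ac)
    then show ?thesis
      by (simp only: abs_le_square_iff)
  qed
  have s2: "\<bar>s2\<bar> \<le> 2 * w\<^sup>2"
  proof -
    have "(cos x)\<^sup>2 - (sin x)\<^sup>2 = cos (2 * x)"
      by (simp add: cos_double)
    then show ?thesis
      by (simp add: s2_def abs_mult mult_left_le)
  qed
  have "\<bar>s2 / D\<^sup>2 - 2 * s1\<^sup>2 / D ^ 3\<bar> \<le> \<bar>s2 / D\<^sup>2\<bar> + \<bar>2 * s1\<^sup>2 / D ^ 3\<bar>"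
    by (rule abs_triangle_ineq4)
  also have "\<dots> = \<bar>s2\<bar> / D\<^sup>2 + 2 * s1\<^sup>2 / D ^ 3"
    using D by simp
  also have "\<dots> \<le> 2 * w\<^sup>2 / D\<^sup>2 + 2 * (w * D / a)\<^sup>2 / D ^ 3"
    using s1 s2 D by (intro add_mono divide_right_mono mult_left_mono) auto
  also have "2 * (w * D / a)\<^sup>2 / D ^ 3 = 2 * w\<^sup>2 / (a\<^sup>2 * D)"
    using D a by (simp add: field_simps power2_eq_square power3_eq_cube)
  also have "2 * w\<^sup>2 / D\<^sup>2 + 2 * w\<^sup>2 / (a\<^sup>2 * D) \<le> 2 * w\<^sup>2 / (a\<^sup>2)\<^sup>2 + 2 * w\<^sup>2 / (a\<^sup>2 * a\<^sup>2)"
    using D a by (intro add_mono divide_left_mono power_mono mult_left_mono) auto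
  also have "\<dots> = 4 * w\<^sup>2 / (a\<^sup>2 * a\<^sup>2)"
    by (simp add: power2_eq_square)
  finally have "2 * a\<^sup>2 * \<bar>s2 / D\<^sup>2 - 2 * s1\<^sup>2 / D ^ 3\<bar> \<le> 2 * a\<^sup>2 * (4 * w\<^sup>2 / (a\<^sup>2 * a\<^sup>2))"
    by (intro mult_left_mono) auto
  also have "\<dots> = 8 * w\<^sup>2 / a\<^sup>2"
    using a by (simp add: field_simps)
  finally show ?thesis
    by (simp add: circle_bump''_def abs_mult flip: x_def D_def s1_def s2_def)
qed

end

lemma circle_bump_periodic:
  assumes "w = pi / L" "L \<noteq> 0"
  shows "circle_bump w a p (y + L) = circle_bump w a p y"
    and "circle_bump' w a p (y + L) = circle_bump' w a p y"
proof -
  have "w * (y + L - p) = w * (y - p) + pi"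
    using assms by (simp add: field_simps)
  then show "circle_bump w a p (y + L) = circle_bump w a p y"
    and "circle_bump' w a p (y + L) = circle_bump' w a p y"
    by (simp_all add: circle_bump_def circle_bump'_def)
qed

text \<open>The antiderivative is a branch of \<open>arctan ((b / a) * tan x)\<close> made continuous across the
  poles of the tangent.\<close>

lemma integral_circle_bump_le:
  assumes "a > 0" "L > 0" "w = pi / L"
  shows "(\<integral>y. circle_bump w a p y \<partial>circle_measure L) \<le> 2 * L * a"
proof -
  define b where "b = sqrt (1 + a\<^sup>2)"
  have b: "b \<ge> 1" "b\<^sup>2 = 1 + a\<^sup>2"
    by (auto simp: b_def)
  have wpos: "w > 0"
    using assms by simp
  \<comment> \<open>If tan \<theta> = (b / a) tan x, the quotient is tan (\<theta> - x), with
    numerator and denominator multiplied by the squared cosine. The new denominator is at least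
    \<open>a\<close>, so the poles are gone.\<close>
  define \<Phi> where "\<Phi> = (\<lambda>x. x + arctan ((b - a) * sin x * cos x / (a * (cos x)\<^sup>2 + b * (sin x)\<^sup>2)))"
  have \<Phi>: "(\<Phi> has_real_derivative a * b / ((sin x)\<^sup>2 + a\<^sup>2)) (at x)" for x
  proof -
    define s c where "s = sin x" and "c = cos x"
    have sc: "s\<^sup>2 + c\<^sup>2 = 1"
      by (simp add: s_def c_def)
    define E where "E = a * c\<^sup>2 + b * s\<^sup>2"
    define F where "F = (b - a) * s * c"
    have "a * 1 \<le> a * c\<^sup>2 + b * s\<^sup>2"
    proof (cases "a \<le> b")
      case True
      have "a * 1 = a * c\<^sup>2 + a * s\<^sup>2"
        using sc by (simp add: distrib_left[symmetric] add.commute)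
      also have "\<dots> \<le> a * c\<^sup>2 + b * s\<^sup>2"
        using True by (intro add_left_mono mult_right_mono) auto
      finally show ?thesis .
    next
      case False
      moreover have "a \<le> b"
        unfolding b_def by (rule real_le_rsqrt) simp
      ultimately show ?thesis by simp
    qed
    then have E: "E > 0"
      using assms by (simp add: E_def)
    \<comment> \<open>This is where b^2 = 1 + a^2 enters: the mixed terms cancel, a^2 cos^2 + b^2
      sin^2 is left, and it equals the denominator of the bump.\<close>
    have EF: "E\<^sup>2 + F\<^sup>2 = s\<^sup>2 + a\<^sup>2"
    proof -
      have c2: "c\<^sup>2 = 1 - s\<^sup>2"
        using sc by simp
      have "F\<^sup>2 = (b\<^sup>2 - 2 * a * b + a\<^sup>2) * s\<^sup>2 * c\<^sup>2"
        unfolding F_def by algebra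
      moreover have "E\<^sup>2 = a\<^sup>2 * (c\<^sup>2)\<^sup>2 + 2 * a * b * c\<^sup>2 * s\<^sup>2 + b\<^sup>2 * (s\<^sup>2)\<^sup>2"
        unfolding E_def by algebra
      ultimately show ?thesis
        unfolding c2 b(2) by (simp add: algebra_simps power2_eq_square)
    qed
    have dE: "((\<lambda>x. a * (cos x)\<^sup>2 + b * (sin x)\<^sup>2) has_real_derivative 2 * (b - a) * s * c) (at x)"
      unfolding s_def c_def by (auto intro!: derivative_eq_intros simp: algebra_simps)
    have dF: "((\<lambda>x. (b - a) * sin x * cos x) has_real_derivative (b - a) * (c\<^sup>2 - s\<^sup>2)) (at x)"
      unfolding s_def c_def
      by (auto intro!: derivative_eq_intros simp: algebra_simps power2_eq_square)
    have dFE: "((\<lambda>x. (b - a) * sin x * cos x / (a * (cos x)\<^sup>2 + b * (sin x)\<^sup>2)) has_real_derivative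
        (((b - a) * (c\<^sup>2 - s\<^sup>2)) * E - F * (2 * (b - a) * s * c)) / E\<^sup>2) (at x)"
      using DERIV_divide[OF dF dE] E unfolding E_def F_def s_def c_def
      by (simp add: power2_eq_square)
    have "(\<Phi> has_real_derivative 1 + (((b - a) * (c\<^sup>2 - s\<^sup>2)) * E - F * (2 * (b - a) * s * c)) / E\<^sup>2
        / (1 + (F / E)\<^sup>2)) (at x)"
      using DERIV_add[OF DERIV_ident DERIV_chain2[OF DERIV_arctan dFE]]
      unfolding \<Phi>_def E_def F_def s_def c_def by (simp add: divide_inverse mult.commute)
    also have "1 + (((b - a) * (c\<^sup>2 - s\<^sup>2)) * E - F * (2 * (b - a) * s * c)) / E\<^sup>2 / (1 + (F / E)\<^sup>2)
        = 1 + (((b - a) * (c\<^sup>2 - s\<^sup>2)) * E - F * (2 * (b - a) * s * c)) / (s\<^sup>2 + a\<^sup>2)"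
    proof -
      have "E\<^sup>2 * (1 + (F / E)\<^sup>2) = s\<^sup>2 + a\<^sup>2"
        using E EF by (simp add: power_divide distrib_left)
      then show ?thesis
        by (simp add: divide_divide_eq_left)
    qed
    also have "((b - a) * (c\<^sup>2 - s\<^sup>2)) * E - F * (2 * (b - a) * s * c) = a * b - (s\<^sup>2 + a\<^sup>2)"
    proof -
      have c2: "c\<^sup>2 = 1 - s\<^sup>2"
        using sc by simp
      have "F * (2 * (b - a) * s * c) = 2 * (b\<^sup>2 - 2 * a * b + a\<^sup>2) * s\<^sup>2 * c\<^sup>2"
        by (simp add: F_def power2_eq_square algebra_simps)
      moreover have "((b - a) * (c\<^sup>2 - s\<^sup>2)) * E
          = (a * b - a\<^sup>2) * (c\<^sup>2 - s\<^sup>2) * c\<^sup>2 + (b\<^sup>2 - a * b) * (c\<^sup>2 - s\<^sup>2) * s\<^sup>2"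
        by (simp add: E_def power2_eq_square algebra_simps)
      ultimately show ?thesis
        unfolding c2 b(2) by (simp add: algebra_simps power2_eq_square)
    qed
    also have "1 + (a * b - (s\<^sup>2 + a\<^sup>2)) / (s\<^sup>2 + a\<^sup>2) = a * b / (s\<^sup>2 + a\<^sup>2)"
      using circle_bump_denominator(3)[OF assms(1), of x] by (simp add: s_def diff_divide_distrib)
    finally show ?thesis
      by (simp add: s_def)
  qed
  define \<Psi> where "\<Psi> = (\<lambda>y. 2 * a / (b * w) * \<Phi> (w * (y - p)))"
  have \<Psi>: "(\<Psi> has_vector_derivative circle_bump w a p y) (at y)" for y
  proof -
    have "(\<Psi> has_real_derivative 2 * a / (b * w) * (a * b / ((sin (w * (y - p)))\<^sup>2 + a\<^sup>2) * w)) (at y)"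
      unfolding \<Psi>_def
      by (intro DERIV_cmult DERIV_chain2[OF \<Phi>]) (auto intro!: derivative_eq_intros)
    also have "2 * a / (b * w) * (a * b / ((sin (w * (y - p)))\<^sup>2 + a\<^sup>2) * w) = circle_bump w a p y"
      using b wpos by (simp add: circle_bump_def power2_eq_square)
    finally show ?thesis
      by (simp add: has_real_derivative_iff_has_vector_derivative)
  qed
  have "(\<integral>y. circle_bump w a p y \<partial>circle_measure L) = \<Psi> L - \<Psi> 0"
    using assms circle_bump_deriv[OF assms(1)]
    by (intro integral_circle_deriv \<Psi> continuous_at_imp_continuous_on ballI DERIV_isCont) auto
  also have "\<dots> = 2 * a / (b * w) * pi"
  proof -
    \<comment> \<open>Over one period the argument grows by pi. The arctan term has period pi, so
      only the linear term of \<open>\<Phi>\<close> contributes.\<close>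
    have "w * (L - p) = - (w * p) + pi"
      using assms by (simp add: field_simps)
    then have "\<Phi> (w * (L - p)) = \<Phi> (w * (0 - p)) + pi"
      by (simp add: \<Phi>_def)
    then show ?thesis
      by (simp add: \<Psi>_def algebra_simps add_divide_distrib)
  qed
  also have "\<dots> = 2 * L * a / b"
    using assms by simp
  also have "\<dots> \<le> 2 * L * a"
    using b assms by (simp add: field_simps)
  finally show ?thesis .
qed

section \<open>Distance on the circle and representatives of points\<close>

lemma circle_dist_lessE:
  assumes "circle_dist L x y < d"
  obtains n :: int where "\<bar>x - y + of_int n * L\<bar> < d"
proof -
  have "bdd_below (range (\<lambda>n::int. \<bar>x - y + of_int n * L\<bar>))"
    by (rule bdd_belowI[of _ 0]) auto
  then show ?thesis
    using assms that unfolding circle_dist_def by (subst (asm) cINF_less_iff) auto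
qed

text \<open>The modulus of the sine has period pi, so it does not see which integer multiple of
  \<open>L\<close> realises the distance; then |sin x| \<le> |x| applies. This is why the bumps are
  built from sin (pi / L * (y - p)).\<close>

lemma abs_sin_less_circle_dist:
  assumes "L > 0" "circle_dist L y p < \<delta>"
  shows "\<bar>sin (pi / L * (y - p))\<bar> < pi / L * \<delta>"
proof -
  obtain n :: int where n: "\<bar>y - p + of_int n * L\<bar> < \<delta>"
    using circle_dist_lessE[OF assms(2)] .
  define x where "x = pi / L * (y - p)"
  have x: "pi / L * (y - p + of_int n * L) = x + pi * of_int n"
    using assms by (simp add: x_def field_simps)
  have "\<bar>sin x\<bar> = \<bar>sin (x + pi * of_int n)\<bar>"
    by (simp add: sin_add cos_npi_int sin_npi_int)
  also have "\<dots> \<le> \<bar>x + pi * of_int n\<bar>"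
    by (rule abs_sin_x_le_abs_x)
  also have "\<dots> = pi / L * \<bar>y - p + of_int n * L\<bar>"
    using assms by (simp add: abs_mult flip: x)
  also have "\<dots> < pi / L * \<delta>"
    using n assms by (intro mult_strict_left_mono) auto
  finally show ?thesis
    by (simp add: x_def)
qed

text \<open>The representative is chosen before \<open>f\<close>, so that \<open>u\<close> and the
  sum \<open>K\<close> of the bumps can be moved to the same point of {0..<L}, where the lower bound
  on |u - l| is available.\<close>

lemma periodic_fundamental_domain:
  fixes L y :: real
  assumes "L > 0"
  obtains y0 where "y0 \<in> {0..<L}" "\<And>f. (\<And>x. f (x + L) = f x) \<Longrightarrow> f y0 = f y"
proof -
  have per: "f (x + of_nat n * L) = f x" if "\<And>x. f (x + L) = f x" for f :: "real \<Rightarrow> 'b" and x n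
  proof (induction n)
    case (Suc n)
    have "f (x + of_nat (Suc n) * L) = f ((x + of_nat n * L) + L)"
      by (simp add: algebra_simps)
    then show ?case
      using that Suc by simp
  qed simp
  define z where "z = \<lfloor>y / L\<rfloor>"
  have "of_int z \<le> y / L" "y / L < of_int z + 1"
    unfolding z_def by linarith+
  then have dom: "y - of_int z * L \<in> {0..<L}"
    using assms by (auto simp: field_simps)
  have "f (y - of_int z * L) = f y" if "\<And>x. f (x + L) = f x" for f :: "real \<Rightarrow> 'b"
  proof (cases "z \<ge> 0")
    case True
    then show ?thesis
      using per[of f "y - of_int z * L" "nat z", OF that] by simp
  next
    case False
    then show ?thesis
      using per[of f y "nat (- z)", OF that] by simp
  qed
  then show ?thesis
    using dom that by blast
qed

text \<open>The cutoff is \<open>\<eta> = sgn (u - l) * max 0 (1 - K) ^ 3\<close>, where \<open>K\<close> is the sum of the bumps at the points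
  \<open>p j\<close>. It is twice continuously differentiable because \<open>K > 1\<close> near the zeros of \<open>u - l\<close>.\<close>

lemma cutoff_exists:
  fixes u :: "real \<Rightarrow> real" and p :: "nat \<Rightarrow> real"
  assumes L: "L > 0" and \<delta>: "\<delta> > 0" and nN: "n \<le> N" and c: "c > 0"
    and cont: "\<And>y. isCont u y" and per: "\<And>y. u (y + L) = u y"
    and far: "\<And>y. y \<in> {0..<L} \<Longrightarrow> (\<And>j. j \<in> {1..n} \<Longrightarrow> circle_dist L y (p j) \<ge> \<delta>) \<Longrightarrow> \<bar>u y - l\<bar> \<ge> c"
  obtains \<eta> \<eta>' \<eta>'' K :: "real \<Rightarrow> real" where
    "\<And>y. (\<eta> has_real_derivative \<eta>' y) (at y)" "\<And>y. (\<eta>' has_real_derivative \<eta>'' y) (at y)"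
    "\<And>y. isCont \<eta>'' y" "\<eta> L = \<eta> 0" "\<eta>' L = \<eta>' 0"
    "\<And>y. \<bar>\<eta> y\<bar> \<le> 1" "\<And>y. \<bar>\<eta>' y\<bar> \<le> 6 * real N / \<delta>"
    "\<And>y. \<bar>\<eta>'' y\<bar> \<le> (24 * (real N)\<^sup>2 + 24 * real N) / \<delta>\<^sup>2"
    "\<And>y. c * \<bar>\<eta> y\<bar> \<le> \<eta> y * (u y - l)" "\<And>y. 1 \<le> 8 * \<bar>\<eta> y\<bar> + 2 * K y"
    "\<And>y. K y \<ge> 0" "\<And>y. isCont K y"
    "(\<integral>y. K y \<partial>circle_measure L) \<le> 2 * pi * real N * \<delta>"
proof -
  define w a where "w = pi / L" and "a = w * \<delta>"
  have pos: "w > 0" "a > 0"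
    using L \<delta> by (auto simp: w_def a_def)
  define K K1 K2 where "K = (\<lambda>y. \<Sum>j\<in>{1..n}. circle_bump w a (p j) y)"
    and "K1 = (\<lambda>y. \<Sum>j\<in>{1..n}. circle_bump' w a (p j) y)"
    and "K2 = (\<lambda>y. \<Sum>j\<in>{1..n}. circle_bump'' w a (p j) y)"
  have K: "(K has_real_derivative K1 y) (at y)" and K1: "(K1 has_real_derivative K2 y) (at y)" for y
    unfolding K_def K1_def K2_def using pos
    by (auto intro!: DERIV_sum circle_bump_deriv circle_bump'_deriv)
  have K2: "isCont K2 y" for y
    unfolding K2_def using pos by (intro continuous_intros isCont_circle_bump'')
  have Kper: "K (y + L) = K y" "K1 (y + L) = K1 y" for y
    using L by (simp_all add: K_def K1_def circle_bump_periodic w_def)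
  have Knn: "K y \<ge> 0" for y
    unfolding K_def using pos by (intro sum_nonneg circle_bump_nonneg)
  have K1_le: "\<bar>K1 y\<bar> \<le> 2 * real N / \<delta>" for y
  proof -
    have "\<bar>K1 y\<bar> \<le> (\<Sum>j\<in>{1..n}. 2 * w / a)"
      unfolding K1_def using pos
      by (intro order_trans[OF sum_abs] sum_mono abs_circle_bump'_le)
    also have "\<dots> = real n * (2 / \<delta>)"
      using pos \<delta> by (simp add: a_def)
    also have "\<dots> \<le> real N * (2 / \<delta>)"
      using nN \<delta> by (intro mult_right_mono) auto
    finally show ?thesis
      by (simp add: mult.commute)
  qed
  have K2_le: "\<bar>K2 y\<bar> \<le> 8 * real N / \<delta>\<^sup>2" for y
  proof -
    have "\<bar>K2 y\<bar> \<le> (\<Sum>j\<in>{1..n}. 8 * w\<^sup>2 / a\<^sup>2)"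
      unfolding K2_def using pos
      by (intro order_trans[OF sum_abs] sum_mono abs_circle_bump''_le)
    also have "\<dots> = real n * (8 / \<delta>\<^sup>2)"
      using pos \<delta> by (simp add: a_def power_mult_distrib)
    also have "\<dots> \<le> real N * (8 / \<delta>\<^sup>2)"
      using nN \<delta> by (intro mult_right_mono) auto
    finally show ?thesis
      by (simp add: mult.commute)
  qed
  \<comment> \<open>By contraposition: a point within \<delta> of some \<open>p j\<close> has a
    single bump above 1 there, and since the bumps are nonnegative their sum exceeds 1 as
    well.\<close>
  have gap: "\<bar>u y - l\<bar> \<ge> c" if "K y \<le> 1" for y
  proof -
    obtain y0 where y0: "y0 \<in> {0..<L}" and eq: "u y0 = u y" "K y0 = K y"
      using periodic_fundamental_domain[OF L, of y] per Kper by metis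
    have "\<bar>u y0 - l\<bar> \<ge> c"
    proof (rule far[OF y0])
      fix j assume j: "j \<in> {1..n}"
      show "circle_dist L y0 (p j) \<ge> \<delta>"
      proof (rule ccontr)
        assume "\<not> ?thesis"
        then have "\<bar>sin (w * (y0 - p j))\<bar> < a"
          using abs_sin_less_circle_dist[OF L] by (simp add: w_def a_def)
        then have "1 < circle_bump w a (p j) y0"
          using pos by (intro circle_bump_gt_1)
        also have "\<dots> \<le> K y0"
          unfolding K_def using pos j by (intro member_le_sum circle_bump_nonneg) auto
        finally show False
          using that eq by simp
      qed
    qed
    then show ?thesis
      using eq by simp
  qed
  define \<theta> where "\<theta> = (\<lambda>y. 1 - K y)"
  have \<theta>: "(\<theta> has_real_derivative - K1 y) (at y)" for y
    unfolding \<theta>_def by (auto intro!: derivative_eq_intros K)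
  have \<theta>_le: "max 0 (\<theta> y) \<le> 1" for y
    using Knn by (simp add: \<theta>_def)
  have ev: "\<forall>\<^sub>F z in nhds y. max 0 (\<theta> z) = 0" if "u y - l = 0" for y
  proof -
    have "\<theta> y < 0"
      using gap[of y] that c by (fastforce simp: \<theta>_def)
    moreover have "isCont \<theta> y"
      using \<theta> by (rule DERIV_isCont)
    ultimately have "\<forall>\<^sub>F z in nhds y. \<theta> z < 0"
      by (simp add: isCont_def tendsto_at_iff_tendsto_nhds order_tendstoD)
    then show ?thesis
      by eventually_elim simp
  qed
  define f f1 f2 where "f = (\<lambda>y. max 0 (\<theta> y) ^ 3)"
    and "f1 = (\<lambda>y. 3 * max 0 (\<theta> y) ^ 2 * - K1 y)"
    and "f2 = (\<lambda>y. 3 * (2 * max 0 (\<theta> y) * - K1 y) * - K1 y + 3 * max 0 (\<theta> y) ^ 2 * - K2 y)"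
  have f: "(f has_real_derivative f1 y) (at y)" for y
    unfolding f_def f1_def
    using DERIV_chain2[OF has_real_derivative_max_0_power[of 3 "\<theta> y"] \<theta>] by simp
  have f1: "(f1 has_real_derivative f2 y) (at y)" for y
  proof -
    have "((\<lambda>y. max 0 (\<theta> y) ^ 2) has_real_derivative 2 * max 0 (\<theta> y) * - K1 y) (at y)"
      using DERIV_chain2[OF has_real_derivative_max_0_power[of 2 "\<theta> y"] \<theta>] by simp
    from DERIV_mult[OF DERIV_cmult[OF this, of 3] DERIV_minus[OF K1]] show ?thesis
      unfolding f1_def f2_def by (simp add: algebra_simps)
  qed
  have f2: "isCont f2 y" for y
    unfolding f2_def using \<theta>[THEN DERIV_isCont] K1[THEN DERIV_isCont] K2
    by (intro continuous_intros) auto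
  have ev': "\<forall>\<^sub>F z in nhds y. f z = 0" "\<forall>\<^sub>F z in nhds y. f1 z = 0" "\<forall>\<^sub>F z in nhds y. f2 z = 0"
    if "u y - l = 0" for y
    using ev[OF that] by (eventually_elim, simp add: f_def f1_def f2_def)+
  define \<sigma> where "\<sigma> = (\<lambda>y. sgn (u y - l))"
  have \<sigma>: "\<bar>\<sigma> y * x\<bar> \<le> \<bar>x\<bar>" for x y
    by (auto simp: \<sigma>_def abs_mult sgn_if)
  have contv: "isCont (\<lambda>y. u y - l) y" for y
    by (intro continuous_intros cont)
  have fnn: "f y \<ge> 0" "f y \<le> 1" for y
    using \<theta>_le by (auto simp: f_def power_le_one)
  have f_gap: "f y = 0 \<or> \<bar>u y - l\<bar> \<ge> c" for y
    using gap[of y] by (cases "K y \<le> 1") (auto simp: f_def \<theta>_def)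
  show ?thesis
  proof (rule that[of "\<lambda>y. \<sigma> y * f y" "\<lambda>y. \<sigma> y * f1 y" "\<lambda>y. \<sigma> y * f2 y" K])
    fix y
    show "((\<lambda>y. \<sigma> y * f y) has_real_derivative \<sigma> y * f1 y) (at y)"
      unfolding \<sigma>_def by (intro has_real_derivative_sgn_mult contv ev' f)
    show "((\<lambda>y. \<sigma> y * f1 y) has_real_derivative \<sigma> y * f2 y) (at y)"
      unfolding \<sigma>_def by (intro has_real_derivative_sgn_mult contv ev' f1)
    show "isCont (\<lambda>y. \<sigma> y * f2 y) y"
      unfolding \<sigma>_def by (intro isCont_sgn_mult contv ev' f2)
    show "\<bar>\<sigma> y * f y\<bar> \<le> 1"
      using \<sigma>[of y "f y"] fnn[of y] by linarith
    show "\<bar>\<sigma> y * f1 y\<bar> \<le> 6 * real N / \<delta>"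
    proof -
      have "\<bar>f1 y\<bar> = 3 * max 0 (\<theta> y) ^ 2 * \<bar>K1 y\<bar>"
        by (simp add: f1_def abs_mult)
      also have "\<dots> \<le> 3 * 1 * (2 * real N / \<delta>)"
        using \<theta>_le K1_le by (intro mult_mono power_le_one) auto
      finally show ?thesis
        using \<sigma>[of y "f1 y"] by simp
    qed
    show "\<bar>\<sigma> y * f2 y\<bar> \<le> (24 * (real N)\<^sup>2 + 24 * real N) / \<delta>\<^sup>2"
    proof -
      \<comment> \<open>The chain rule gives 6 (K')^2 + 3 |K''| as a bound, because the positive
        part is at most 1. With K' and K'' bounded by 2 N / \<delta> and 8 N / \<delta>^2 this is
        the source of 24 N^2 + 24 N.\<close>
      have "\<bar>f2 y\<bar> \<le> 6 * max 0 (\<theta> y) * \<bar>K1 y\<bar>\<^sup>2 + 3 * max 0 (\<theta> y) ^ 2 * \<bar>K2 y\<bar>"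
        unfolding f2_def by (rule order_trans[OF abs_triangle_ineq]) (simp add: abs_mult power2_eq_square)
      also have "\<dots> \<le> 6 * 1 * (2 * real N / \<delta>)\<^sup>2 + 3 * 1 * (8 * real N / \<delta>\<^sup>2)"
        using \<theta>_le[of y] K1_le[of y] K2_le[of y]
        by (intro add_mono mult_mono power_mono power_le_one) auto
      also have "\<dots> = (24 * (real N)\<^sup>2 + 24 * real N) / \<delta>\<^sup>2"
        by (simp add: power_divide power_mult_distrib add_divide_distrib)
      finally show ?thesis
        using \<sigma>[of y "f2 y"] by simp
    qed
    \<comment> \<open>Where \<open>f\<close> is nonzero, |u - l| \<ge> c > 0, so the sign is 1 or -1
      and not the value 0 of \<open>sgn\<close> at 0.\<close>
    have abs: "\<bar>\<sigma> y * f y\<bar> = f y"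
      using f_gap[of y] fnn[of y] c by (auto simp: \<sigma>_def abs_mult sgn_if)
    have eq: "\<sigma> y * f y * (u y - l) = \<bar>u y - l\<bar> * f y"
      by (auto simp: \<sigma>_def sgn_if)
    show "c * \<bar>\<sigma> y * f y\<bar> \<le> \<sigma> y * f y * (u y - l)"
      unfolding abs eq using f_gap[of y] fnn[of y] by (auto intro: mult_right_mono)
    \<comment> \<open>The two cases K \<ge> 1/2 and K < 1/2 explain the constants: in the second the
      cutoff is at least (1/2)^3 = 1/8.\<close>
    show "1 \<le> 8 * \<bar>\<sigma> y * f y\<bar> + 2 * K y"
    proof (cases "K y \<ge> 1 / 2")
      case True
      then show ?thesis
        using fnn[of y] by (simp add: abs)
    next
      case False
      then have "(1 / 2) ^ 3 \<le> f y"
        unfolding f_def \<theta>_def by (intro power_mono) auto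
      then show ?thesis
        using Knn[of y] unfolding abs by (simp add: power3_eq_cube)
    qed
    show "K y \<ge> 0"
      by (rule Knn)
    show "isCont K y"
      using K by (rule DERIV_isCont)
  next
    have "\<theta> L = \<theta> 0" "u L = u 0" "K1 L = K1 0"
      using Kper[of 0] per[of 0] by (simp_all add: \<theta>_def)
    then show "\<sigma> L * f L = \<sigma> 0 * f 0" "\<sigma> L * f1 L = \<sigma> 0 * f1 0"
      by (simp_all add: \<sigma>_def f_def f1_def)
    have "(\<integral>y. K y \<partial>circle_measure L) = (\<Sum>j\<in>{1..n}. \<integral>y. circle_bump w a (p j) y \<partial>circle_measure L)"
      unfolding K_def
      by (intro Bochner_Integration.integral_sum integrable_continuous_circle
          continuous_at_imp_continuous_on ballI DERIV_isCont[OF circle_bump_deriv[OF pos(2)]])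
    also have "\<dots> \<le> (\<Sum>j\<in>{1..n}. 2 * L * a)"
      using pos L by (intro sum_mono integral_circle_bump_le) (auto simp: w_def)
    also have "\<dots> = real n * (2 * pi * \<delta>)"
      using L by (simp add: a_def w_def)
    also have "\<dots> \<le> real N * (2 * pi * \<delta>)"
      using nN \<delta> by (intro mult_right_mono) auto
    finally show "(\<integral>y. K y \<partial>circle_measure L) \<le> 2 * pi * real N * \<delta>"
      by (simp add: mult_ac)
  qed
qed

section \<open>Energy estimates\<close>

lemma oscillation_le_integral_deriv:
  fixes f :: "real \<Rightarrow> real"
  assumes f: "\<And>y. (f has_vector_derivative f' y) (at y)" "continuous_on UNIV f'"
    and xz: "x \<in> {0..L}" "z \<in> {0..L}"
  shows "f x - f z \<le> (\<integral>y. \<bar>f' y\<bar> \<partial>circle_measure L)"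
proof -
  have int: "(\<lambda>y. \<bar>f' y\<bar>) integrable_on {s..t}" "f' integrable_on {s..t}" for s t
    using f(2) by (intro integrable_continuous_real continuous_intros; force intro: continuous_on_subset)+
  have "\<bar>f t - f s\<bar> \<le> integral {0..L} (\<lambda>y. \<bar>f' y\<bar>)" if "s \<le> t" "0 \<le> s" "t \<le> L" for s t
  proof -
    have "(f' has_integral (f t - f s)) {s..t}"
      using f(1) that by (intro fundamental_theorem_of_calculus) (auto intro: has_vector_derivative_at_within)
    then have "f t - f s = integral {s..t} f'"
      by (simp add: integral_unique)
    also have "\<bar>\<dots>\<bar> \<le> integral {s..t} (\<lambda>y. \<bar>f' y\<bar>)"
      using integral_norm_bound_integral[OF int(2) int(1)] by simp
    also have "\<dots> \<le> integral {0..L} (\<lambda>y. \<bar>f' y\<bar>)"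
      using that int by (intro integral_subset_le) auto
    finally show ?thesis .
  qed
  from this[of x z] this[of z x] xz have "f x - f z \<le> integral {0..L} (\<lambda>y. \<bar>f' y\<bar>)"
    by (cases "x \<le> z") auto
  then show ?thesis
    using f(2) by (simp add: integral_circle_eq continuous_on_rabs)
qed

lemma has_vector_derivative_cnj:
  "(f has_vector_derivative f') F \<Longrightarrow> ((\<lambda>x. cnj (f x)) has_vector_derivative cnj f') F"
  by (rule bounded_linear.has_vector_derivative[OF bounded_linear_cnj])

lemma integral_circle_mult_second_deriv:
  fixes f h :: "real \<Rightarrow> complex"
  assumes "L \<ge> 0"
    and f: "\<And>x. (f has_vector_derivative f1 x) (at x)" "\<And>x. (f1 has_vector_derivative f2 x) (at x)"
      "continuous_on UNIV f2" "f L = f 0" "f1 L = f1 0"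
    and h: "\<And>x. (h has_vector_derivative h1 x) (at x)" "\<And>x. (h1 has_vector_derivative h2 x) (at x)"
      "continuous_on UNIV h2" "h L = h 0" "h1 L = h1 0"
  shows "(\<integral>y. f2 y * h y \<partial>circle_measure L) = (\<integral>y. f y * h2 y \<partial>circle_measure L)"
proof -
  have cont: "continuous_on UNIV f1" "continuous_on UNIV h1"
    using f(2) h(2) by (meson continuous_at_imp_continuous_on has_vector_derivative_continuous)+
  have "(\<integral>y. f2 y * h y \<partial>circle_measure L) = - (\<integral>y. f1 y * h1 y \<partial>circle_measure L)"
    using integral_circle_by_parts[OF assms(1) f(2,3,5) h(1) cont(2) h(4)] by simp
  also have "\<dots> = (\<integral>y. f y * h2 y \<partial>circle_measure L)"
    using integral_circle_by_parts[OF assms(1) f(1) cont(1) f(4) h(2,3,5)] by simp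
  finally show ?thesis .
qed

lemma of_real_cmod_power2: "(complex_of_real (cmod z))\<^sup>2 = z * cnj z"
  by (metis complex_norm_square of_real_power)

text \<open>\<open>g j\<close> is the \<open>j\<close>-th derivative of \<open>g 0\<close>.\<close>

locale circle_C4 =
  fixes L :: real and g :: "nat \<Rightarrow> real \<Rightarrow> complex"
  assumes L: "L > 0"
    and deriv: "\<And>j y. j < 4 \<Longrightarrow> (g j has_vector_derivative g (Suc j) y) (at y)"
    and cont4: "continuous_on UNIV (g 4)"
    and periodic: "\<And>j. j < 4 \<Longrightarrow> g j L = g j 0"
begin

lemma cont: "j \<le> 4 \<Longrightarrow> continuous_on UNIV (g j)"
proof (cases "j = 4")
  case False
  moreover assume "j \<le> 4"
  ultimately show ?thesis
    using deriv[of j] by (meson continuous_at_imp_continuous_on has_vector_derivative_continuous le_neq_implies_less)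
qed (use cont4 in simp)

lemma derivs:
  "(g 0 has_vector_derivative g 1 y) (at y)" "(g 1 has_vector_derivative g 2 y) (at y)"
  "(g 2 has_vector_derivative g 3 y) (at y)" "(g 3 has_vector_derivative g 4 y) (at y)"
  using deriv[of 0 y] deriv[of 1 y] deriv[of 2 y] deriv[of 3 y]
  by (simp_all add: numeral_2_eq_2 numeral_3_eq_3 eval_nat_numeral)

lemma conts:
  "continuous_on UNIV (g 0)" "continuous_on UNIV (g 1)" "continuous_on UNIV (g 2)" "continuous_on UNIV (g 3)"
  "continuous_on UNIV (g 4)"
  by (simp_all add: cont)

lemma L2: "j \<le> 4 \<Longrightarrow> g j \<in> circle_L2 L"
  by (intro circle_L2_continuous cont)

text \<open>By \<open>oscillation_le_integral_deriv\<close>, |g|^2 differs from its value at any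
  other point by at most the integral of the modulus of its derivative, hence by twice the product
  of the two norms. Integrating over that other point replaces its value by the mean, which is the
  first summand.\<close>

lemma cmod_power2_le:
  assumes "x \<in> {0..<L}"
  shows "(cmod (g 0 x))\<^sup>2 \<le> (circle_norm L (g 0))\<^sup>2 / L + 2 * circle_norm L (g 0) * circle_norm L (g 1)"
proof -
  let ?M = "circle_measure L"
  define V where "V = 2 * (circle_norm L (g 0) * circle_norm L (g 1))"
  define f where "f = (\<lambda>y. (cmod (g 0 y))\<^sup>2)"
  define f' where "f' = (\<lambda>y. Re (g 0 y * cnj (g 1 y) + g 1 y * cnj (g 0 y)))"
  have f_eq: "f = (\<lambda>y. Re (g 0 y * cnj (g 0 y)))"
    by (simp add: f_def complex_norm_square[symmetric] flip: of_real_power)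
  have f: "(f has_vector_derivative f' y) (at y)" for y
    unfolding f_eq f'_def
    by (intro bounded_linear.has_vector_derivative[OF bounded_linear_Re] has_vector_derivative_mult
        has_vector_derivative_cnj derivs)
  have contf': "continuous_on UNIV f'"
    unfolding f'_def by (intro continuous_intros conts)
  have "\<bar>f' y\<bar> \<le> 2 * cmod (g 0 y * g 1 y)" for y
  proof -
    have "\<bar>f' y\<bar> \<le> cmod (g 0 y * cnj (g 1 y) + g 1 y * cnj (g 0 y))"
      unfolding f'_def by (rule abs_Re_le_cmod)
    also have "\<dots> \<le> 2 * cmod (g 0 y * g 1 y)"
      by (rule order_trans[OF norm_triangle_ineq]) (simp add: norm_mult)
    finally show ?thesis .
  qed
  then have "(\<integral>y. \<bar>f' y\<bar> \<partial>?M) \<le> (\<integral>y. 2 * cmod (g 0 y * g 1 y) \<partial>?M)"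
    by (intro integral_mono integrable_continuous_circle continuous_intros conts contf') auto
  also have "\<dots> \<le> V"
    using circle_Cauchy_Schwarz_abs[of "g 0" L "g 1"] L2 by (simp add: V_def)
  finally have V: "(\<integral>y. \<bar>f' y\<bar> \<partial>?M) \<le> V" .
  have "(\<integral>z. f x - V \<partial>?M) \<le> (\<integral>z. f z \<partial>?M)"
  proof (rule integral_mono)
    show "integrable ?M (\<lambda>z. f x - V)" "integrable ?M f"
      unfolding f_def by (intro integrable_continuous_circle continuous_intros conts)+
    fix z assume "z \<in> space ?M"
    then have "f x - f z \<le> (\<integral>y. \<bar>f' y\<bar> \<partial>?M)"
      using assms by (intro oscillation_le_integral_deriv[OF f contf']) auto
    then show "f x - V \<le> f z"
      using V by simp
  qed
  also have "(\<integral>z. f x - V \<partial>?M) = L * (f x - V)"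
    using L by (simp add: measure_restrict_space)
  finally have "f x - V \<le> (circle_norm L (g 0))\<^sup>2 / L"
    using L by (simp add: f_def circle_norm_power2 field_simps)
  then show ?thesis
    by (simp add: f_def V_def)
qed

text \<open>The mass that the cutoff misses is charged to \<open>K\<close>: there |g|^2 is replaced
  by its supremum, so only the integral of \<open>K\<close>, of order \<delta>, enters.\<close>

lemma integral_square_le_cutoff:
  assumes "\<And>y. isCont \<eta> y" "\<And>y. isCont K y" "\<And>y. K y \<ge> 0" "\<And>y. 1 \<le> 8 * \<bar>\<eta> y\<bar> + 2 * K y"
    and "(\<integral>y. K y \<partial>circle_measure L) \<le> I"
  shows "(circle_norm L (g 0))\<^sup>2 \<le> 8 * (\<integral>y. \<bar>\<eta> y\<bar> * (cmod (g 0 y))\<^sup>2 \<partial>circle_measure L)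
    + 2 * ((circle_norm L (g 0))\<^sup>2 / L + 2 * circle_norm L (g 0) * circle_norm L (g 1)) * I"
proof -
  let ?M = "circle_measure L"
  define S where "S = (circle_norm L (g 0))\<^sup>2 / L + 2 * circle_norm L (g 0) * circle_norm L (g 1)"
  have S: "S \<ge> 0"
    using L by (simp add: S_def)
  have cK: "continuous_on UNIV K" and c\<eta>: "continuous_on UNIV \<eta>"
    using assms(1,2) by (auto intro: continuous_at_imp_continuous_on)
  have int: "integrable ?M K" "integrable ?M (\<lambda>y. \<bar>\<eta> y\<bar> * (cmod (g 0 y))\<^sup>2)" "integrable ?M (\<lambda>y. (cmod (g 0 y))\<^sup>2)"
    by (intro integrable_continuous_circle continuous_intros cK c\<eta> conts)+
  have "(circle_norm L (g 0))\<^sup>2 \<le> (\<integral>y. 8 * (\<bar>\<eta> y\<bar> * (cmod (g 0 y))\<^sup>2) + 2 * S * K y \<partial>?M)"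
    unfolding circle_norm_power2
  proof (rule integral_mono)
    fix y assume "y \<in> space ?M"
    then have "(cmod (g 0 y))\<^sup>2 \<le> S"
      using cmod_power2_le by (simp add: S_def)
    then have "(cmod (g 0 y))\<^sup>2 * K y \<le> S * K y"
      using assms(3) by (intro mult_right_mono)
    moreover have "(cmod (g 0 y))\<^sup>2 * 1 \<le> (cmod (g 0 y))\<^sup>2 * (8 * \<bar>\<eta> y\<bar> + 2 * K y)"
      using assms(4) by (intro mult_left_mono) auto
    ultimately show "(cmod (g 0 y))\<^sup>2 \<le> 8 * (\<bar>\<eta> y\<bar> * (cmod (g 0 y))\<^sup>2) + 2 * S * K y"
      by (simp add: algebra_simps)
  qed (use int in auto)
  also have "\<dots> = 8 * (\<integral>y. \<bar>\<eta> y\<bar> * (cmod (g 0 y))\<^sup>2 \<partial>?M) + 2 * S * (\<integral>y. K y \<partial>?M)"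
    using int by simp
  also have "\<dots> \<le> 8 * (\<integral>y. \<bar>\<eta> y\<bar> * (cmod (g 0 y))\<^sup>2 \<partial>?M) + 2 * S * I"
    using S assms(5) by (intro add_left_mono mult_left_mono) auto
  finally show ?thesis
    by (simp add: S_def)
qed

text \<open>\<open>D\<close> and \<open>D2\<close> are \<open>\<Delta>\<^sub>k\<close> g and
  \<open>\<Delta>\<^sub>k\<close> applied twice to g, written with classical derivatives.\<close>

context
  fixes k :: real and D D2 :: "real \<Rightarrow> complex"
  defines "D \<equiv> \<lambda>y. - (complex_of_real k)\<^sup>2 * g 0 y + g 2 y"
    and "D2 \<equiv> \<lambda>y. - (complex_of_real k)\<^sup>2 * D y + (- (complex_of_real k)\<^sup>2 * g 2 y + g 4 y)"
begin

lemma cont_D: "continuous_on UNIV D" "continuous_on UNIV D2"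
  unfolding D_def D2_def by (intro continuous_intros conts)+

text \<open>Only one of the two Laplacians is moved onto \<open>h\<close>. For \<open>h\<close>
  equal to \<eta> times the conjugate of g this needs just two derivatives of \<eta>, and it
  produces \<eta> |D|^2 up to lower order terms.\<close>

lemma integral_bilaplace_mult:
  assumes h: "\<And>x. (h has_vector_derivative h1 x) (at x)" "\<And>x. (h1 has_vector_derivative h2 x) (at x)"
      "continuous_on UNIV h2" "h L = h 0" "h1 L = h1 0"
  shows "(\<integral>y. D2 y * h y \<partial>circle_measure L) =
    (\<integral>y. D y * (- (complex_of_real k)\<^sup>2 * h y + h2 y) \<partial>circle_measure L)"
proof -
  let ?M = "circle_measure L"
  have ch: "continuous_on UNIV h"
    using h(1) by (meson continuous_at_imp_continuous_on has_vector_derivative_continuous)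
  define E1 E2 where "E1 = (\<lambda>y. - (complex_of_real k)\<^sup>2 * g 1 y + g 3 y)"
    and "E2 = (\<lambda>y. - (complex_of_real k)\<^sup>2 * g 2 y + g 4 y)"
  have E: "(D has_vector_derivative E1 y) (at y)" "(E1 has_vector_derivative E2 y) (at y)" for y
    unfolding D_def E1_def E2_def by (auto intro!: derivative_eq_intros derivs derivs[unfolded One_nat_def])
  have cE: "continuous_on UNIV E2"
    unfolding E2_def by (intro continuous_intros conts)
  have per: "D L = D 0" "E1 L = E1 0"
    using periodic by (simp_all add: D_def E1_def)
  have "(\<integral>y. D2 y * h y \<partial>?M) = (\<integral>y. - (complex_of_real k)\<^sup>2 * (D y * h y) + E2 y * h y \<partial>?M)"
    by (simp add: D2_def E2_def algebra_simps)
  also have "\<dots> = - (complex_of_real k)\<^sup>2 * (\<integral>y. D y * h y \<partial>?M) + (\<integral>y. E2 y * h y \<partial>?M)"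
    by (subst Bochner_Integration.integral_add)
      (auto intro!: integrable_continuous_circle continuous_intros cont_D ch cE)
  also have "(\<integral>y. E2 y * h y \<partial>?M) = (\<integral>y. D y * h2 y \<partial>?M)"
    using L by (intro integral_circle_mult_second_deriv[OF _ E cE per h]) auto
  also have "- (complex_of_real k)\<^sup>2 * (\<integral>y. D y * h y \<partial>?M) + (\<integral>y. D y * h2 y \<partial>?M)
      = (\<integral>y. - (complex_of_real k)\<^sup>2 * (D y * h y) + D y * h2 y \<partial>?M)"
    by (subst Bochner_Integration.integral_add)
      (auto intro!: integrable_continuous_circle continuous_intros cont_D ch h)
  finally show ?thesis
    by (simp add: algebra_simps)
qed

text \<open>The real part of the pairing of \<open>D\<close> with g is minus the sum of k^2 times
  the squared norm of g and the squared norm of g'. Both have the same sign, so the first is dropped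
  and the constant is 1 for every \<open>k\<close>.\<close>

lemma norm_deriv_le:
  "(circle_norm L (g 1))\<^sup>2 \<le> circle_norm L D * circle_norm L (g 0)"
proof -
  let ?M = "circle_measure L"
  have "(\<integral>y. g 2 y * cnj (g 0 y) \<partial>?M) = - (\<integral>y. g 1 y * cnj (g 1 y) \<partial>?M)"
    using integral_circle_by_parts[of L "\<lambda>y. cnj (g 0 y)" "\<lambda>y. cnj (g 1 y)" "g 1" "g 2",
        OF _ has_vector_derivative_cnj[OF derivs(1)] _ _ derivs(2) conts(3)]
      L periodic[of 0] periodic[of 1]
    by (simp add: continuous_on_cnj conts[unfolded One_nat_def] mult.commute)
  also have "(\<integral>y. g 1 y * cnj (g 1 y) \<partial>?M) = complex_of_real ((circle_norm L (g 1))\<^sup>2)"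
    by (simp add: circle_norm_power2 complex_norm_square[symmetric] flip: of_real_power)
  finally have by_parts: "(\<integral>y. g 2 y * cnj (g 0 y) \<partial>?M) = - complex_of_real ((circle_norm L (g 1))\<^sup>2)" .
  have "(\<integral>y. D y * cnj (g 0 y) \<partial>?M)
      = (\<integral>y. complex_of_real (- k\<^sup>2 * (cmod (g 0 y))\<^sup>2) + g 2 y * cnj (g 0 y) \<partial>?M)"
    by (simp add: D_def algebra_simps of_real_cmod_power2)
  also have "\<dots> = (\<integral>y. complex_of_real (- k\<^sup>2 * (cmod (g 0 y))\<^sup>2) \<partial>?M) + (\<integral>y. g 2 y * cnj (g 0 y) \<partial>?M)"
    by (intro Bochner_Integration.integral_add integrable_continuous_circle continuous_intros conts)
  also have "(\<integral>y. complex_of_real (- k\<^sup>2 * (cmod (g 0 y))\<^sup>2) \<partial>?M)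
      = complex_of_real (- k\<^sup>2 * (circle_norm L (g 0))\<^sup>2)"
    by (simp only: integral_complex_of_real circle_norm_power2 Bochner_Integration.integral_mult_right_zero)
  finally have "Re (\<integral>y. D y * cnj (g 0 y) \<partial>?M) = - (k\<^sup>2 * (circle_norm L (g 0))\<^sup>2) - (circle_norm L (g 1))\<^sup>2"
    using by_parts by simp
  then have "(circle_norm L (g 1))\<^sup>2 + k\<^sup>2 * (circle_norm L (g 0))\<^sup>2 \<le> cmod (\<integral>y. D y * cnj (g 0 y) \<partial>?M)"
    using abs_Re_le_cmod[of "\<integral>y. D y * cnj (g 0 y) \<partial>?M"] by linarith
  also have "\<dots> \<le> circle_norm L D * circle_norm L (\<lambda>y. cnj (g 0 y))"
    by (intro circle_Cauchy_Schwarz circle_L2_continuous continuous_intros conts cont_D)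
  also have "circle_norm L (\<lambda>y. cnj (g 0 y)) = circle_norm L (g 0)"
    by (simp add: circle_norm_def)
  finally show ?thesis
    by (smt (verit) zero_le_mult_iff zero_le_power2)
qed

text \<open>The imaginary and real parts of \<open>\<integral> F \<eta> g\<^sup>*\<close>; the real part is used only with \<open>\<eta> = 1\<close>.\<close>

lemma cutoff_energy:
  fixes \<nu> :: real and \<eta> \<eta>' \<eta>'' v :: "real \<Rightarrow> real" and F :: "real \<Rightarrow> complex"
  defines "F \<equiv> \<lambda>y. complex_of_real \<nu> * D2 y + \<i> * complex_of_real (v y) * g 0 y"
  assumes \<nu>: "\<nu> \<ge> 0" and v: "continuous_on UNIV v"
    and \<eta>: "\<And>y. (\<eta> has_real_derivative \<eta>' y) (at y)" "\<And>y. (\<eta>' has_real_derivative \<eta>'' y) (at y)"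
      "\<And>y. isCont \<eta>'' y" "\<eta> L = \<eta> 0" "\<eta>' L = \<eta>' 0"
    and le1: "\<And>y. \<bar>\<eta> y\<bar> \<le> 1" and M1: "\<And>y. \<bar>\<eta>' y\<bar> \<le> M1" and M2: "\<And>y. \<bar>\<eta>'' y\<bar> \<le> M2"
  shows "\<bar>\<integral>y. \<eta> y * v y * (cmod (g 0 y))\<^sup>2 \<partial>circle_measure L\<bar> \<le> circle_norm L F * circle_norm L (g 0)
      + \<nu> * (circle_norm L D * (2 * M1 * circle_norm L (g 1) + M2 * circle_norm L (g 0)))" (is ?im)
    and "\<nu> * (\<integral>y. \<eta> y * (cmod (D y))\<^sup>2 \<partial>circle_measure L) \<le> circle_norm L F * circle_norm L (g 0)
      + \<nu> * (circle_norm L D * (2 * M1 * circle_norm L (g 1) + M2 * circle_norm L (g 0)))" (is ?re)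
proof -
  let ?M = "circle_measure L"
  define c\<eta> c\<eta>1 c\<eta>2 where "c\<eta> = (\<lambda>y. complex_of_real (\<eta> y))"
    and "c\<eta>1 = (\<lambda>y. complex_of_real (\<eta>' y))" and "c\<eta>2 = (\<lambda>y. complex_of_real (\<eta>'' y))"
  have d: "(c\<eta> has_vector_derivative c\<eta>1 y) (at y)" "(c\<eta>1 has_vector_derivative c\<eta>2 y) (at y)" for y
    unfolding c\<eta>_def c\<eta>1_def c\<eta>2_def using \<eta>(1,2)
    by (auto intro!: has_vector_derivative_of_real simp: has_real_derivative_iff_has_vector_derivative)
  have cont\<eta>: "continuous_on UNIV \<eta>" "continuous_on UNIV \<eta>'" "continuous_on UNIV \<eta>''"
    using \<eta>(1-3) by (auto intro!: continuous_at_imp_continuous_on intro: DERIV_isCont)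
  then have cc: "continuous_on UNIV c\<eta>" "continuous_on UNIV c\<eta>1" "continuous_on UNIV c\<eta>2"
    unfolding c\<eta>_def c\<eta>1_def c\<eta>2_def by (auto intro!: continuous_intros)
  define h h1 h2 where "h = (\<lambda>y. c\<eta> y * cnj (g 0 y))"
    and "h1 = (\<lambda>y. c\<eta> y * cnj (g 1 y) + c\<eta>1 y * cnj (g 0 y))"
    and "h2 = (\<lambda>y. (c\<eta> y * cnj (g 2 y) + c\<eta>1 y * cnj (g 1 y)) + (c\<eta>1 y * cnj (g 1 y) + c\<eta>2 y * cnj (g 0 y)))"
  have h: "(h has_vector_derivative h1 y) (at y)" "(h1 has_vector_derivative h2 y) (at y)" for y
    unfolding h_def h1_def h2_def
    by (intro has_vector_derivative_add has_vector_derivative_mult has_vector_derivative_cnj d derivs)+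
  have ch: "continuous_on UNIV h" "continuous_on UNIV h2"
    unfolding h_def h2_def by (intro continuous_intros cc conts)+
  have perh: "h L = h 0" "h1 L = h1 0"
    using \<eta>(4,5) periodic by (simp_all add: h_def h1_def c\<eta>_def c\<eta>1_def)
  \<comment> \<open>\<open>R\<close> is the commutator: \<open>\<Delta>\<^sub>k\<close> of \<eta>
    times the conjugate of g, minus \<eta> times the conjugate of \<open>D\<close>. The terms with
    k^2 cancel in it, so the bounds do not grow with \<open>k\<close>.\<close>
  define R where "R = (\<lambda>y. 2 * c\<eta>1 y * cnj (g 1 y) + c\<eta>2 y * cnj (g 0 y))"
  have cR: "continuous_on UNIV R"
    unfolding R_def by (intro continuous_intros cc conts)
  have cF: "continuous_on UNIV F"
    unfolding F_def by (intro continuous_intros cont_D conts v)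
  define J where "J = (\<integral>y. \<eta> y * (cmod (D y))\<^sup>2 \<partial>?M)"
  define Y where "Y = (\<integral>y. \<eta> y * v y * (cmod (g 0 y))\<^sup>2 \<partial>?M)"
  define Z where "Z = (\<integral>y. D y * R y \<partial>?M)"
  have "(\<integral>y. D2 y * h y \<partial>?M) = (\<integral>y. D y * (- (complex_of_real k)\<^sup>2 * h y + h2 y) \<partial>?M)"
    by (rule integral_bilaplace_mult[OF h ch(2) perh])
  also have "\<dots> = (\<integral>y. complex_of_real (\<eta> y * (cmod (D y))\<^sup>2) + D y * R y \<partial>?M)"
  proof (intro Bochner_Integration.integral_cong refl)
    fix y
    have "- (complex_of_real k)\<^sup>2 * h y + h2 y = c\<eta> y * cnj (D y) + R y"
      by (simp add: h_def h2_def R_def D_def algebra_simps)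
    then have "D y * (- (complex_of_real k)\<^sup>2 * h y + h2 y) = D y * (c\<eta> y * cnj (D y) + R y)"
      by simp
    also have "\<dots> = complex_of_real (\<eta> y * (cmod (D y))\<^sup>2) + D y * R y"
      by (simp add: c\<eta>_def of_real_cmod_power2 algebra_simps)
    finally show "D y * (- (complex_of_real k)\<^sup>2 * h y + h2 y)
        = complex_of_real (\<eta> y * (cmod (D y))\<^sup>2) + D y * R y" .
  qed
  also have "\<dots> = (\<integral>y. complex_of_real (\<eta> y * (cmod (D y))\<^sup>2) \<partial>?M) + Z"
    unfolding Z_def
    by (intro Bochner_Integration.integral_add integrable_continuous_circle continuous_intros cont\<eta> cont_D cR)
  also have "(\<integral>y. complex_of_real (\<eta> y * (cmod (D y))\<^sup>2) \<partial>?M) = complex_of_real J"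
    unfolding J_def by (rule integral_complex_of_real)
  finally have D2h: "(\<integral>y. D2 y * h y \<partial>?M) = complex_of_real J + Z" .
  have "(\<integral>y. F y * h y \<partial>?M)
      = (\<integral>y. complex_of_real \<nu> * (D2 y * h y) + \<i> * complex_of_real (\<eta> y * v y * (cmod (g 0 y))\<^sup>2) \<partial>?M)"
    by (intro Bochner_Integration.integral_cong refl)
      (simp add: F_def h_def c\<eta>_def of_real_cmod_power2 algebra_simps)
  also have "\<dots> = (\<integral>y. complex_of_real \<nu> * (D2 y * h y) \<partial>?M)
      + (\<integral>y. \<i> * complex_of_real (\<eta> y * v y * (cmod (g 0 y))\<^sup>2) \<partial>?M)"
    by (intro Bochner_Integration.integral_add integrable_continuous_circle continuous_intros
        cont\<eta> cont_D ch v conts)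
  also have "\<dots> = complex_of_real \<nu> * (complex_of_real J + Z) + \<i> * complex_of_real Y"
    unfolding Y_def D2h[symmetric]
    by (simp only: integral_complex_of_real Bochner_Integration.integral_mult_right_zero)
  finally have Fh: "(\<integral>y. F y * h y \<partial>?M) = complex_of_real \<nu> * (complex_of_real J + Z) + \<i> * complex_of_real Y" .
  have Fh_le: "cmod (\<integral>y. F y * h y \<partial>?M) \<le> circle_norm L F * circle_norm L (g 0)"
  proof -
    have "cmod (\<integral>y. F y * h y \<partial>?M) \<le> circle_norm L F * circle_norm L h"
      by (intro circle_Cauchy_Schwarz circle_L2_continuous cF ch)
    also have "circle_norm L h \<le> 1 * circle_norm L (\<lambda>y. cnj (g 0 y))"
      unfolding h_def using le1
      by (intro circle_norm_mult_bounded circle_L2_continuous continuous_intros conts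
          measurable_continuous_circle cc) (auto simp: c\<eta>_def)
    also have "\<dots> = circle_norm L (g 0)"
      by (simp add: circle_norm_def)
    finally show ?thesis
      by (simp add: mult_left_mono)
  qed
  have Z_le: "cmod Z \<le> circle_norm L D * (2 * M1 * circle_norm L (g 1) + M2 * circle_norm L (g 0))"
  proof -
    have nn: "M1 \<ge> 0" "M2 \<ge> 0"
      using M1[of 0] M2[of 0] by linarith+
    have "cmod Z \<le> circle_norm L D * circle_norm L R"
      unfolding Z_def by (intro circle_Cauchy_Schwarz circle_L2_continuous cR cont_D)
    also have "circle_norm L R \<le> circle_norm L (\<lambda>y. 2 * c\<eta>1 y * cnj (g 1 y)) + circle_norm L (\<lambda>y. c\<eta>2 y * cnj (g 0 y))"
      unfolding R_def by (intro circle_norm_triangle circle_L2_continuous continuous_intros cc conts)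
    also have "\<dots> \<le> 2 * M1 * circle_norm L (\<lambda>y. cnj (g 1 y)) + M2 * circle_norm L (\<lambda>y. cnj (g 0 y))"
      using M1 M2 nn
      by (intro add_mono circle_norm_mult_bounded circle_L2_continuous continuous_intros conts
          measurable_continuous_circle cc) (auto simp: c\<eta>1_def c\<eta>2_def norm_mult)
    also have "\<dots> = 2 * M1 * circle_norm L (g 1) + M2 * circle_norm L (g 0)"
      by (simp add: circle_norm_def)
    finally show ?thesis
      by (simp add: mult_left_mono)
  qed
  \<comment> \<open>\<open>J\<close> and \<open>Y\<close> are real, so the diffusion enters the
    imaginary part only through the commutator integral \<open>Z\<close>, and the transport term is
    absent from the real part.\<close>
  have "Y = Im (\<integral>y. F y * h y \<partial>?M) - \<nu> * Im Z" "\<nu> * J = Re (\<integral>y. F y * h y \<partial>?M) - \<nu> * Re Z"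
    by (simp_all add: Fh algebra_simps)
  moreover have "\<bar>\<nu> * Im Z\<bar> \<le> \<nu> * cmod Z" "\<bar>\<nu> * Re Z\<bar> \<le> \<nu> * cmod Z"
    using \<nu> by (auto simp: abs_mult intro!: mult_left_mono abs_Im_le_cmod abs_Re_le_cmod)
  moreover have "\<nu> * cmod Z \<le> \<nu> * (circle_norm L D * (2 * M1 * circle_norm L (g 1) + M2 * circle_norm L (g 0)))"
    using Z_le \<nu> by (rule mult_left_mono)
  ultimately show ?im ?re
    using Fh_le abs_Im_le_cmod[of "\<integral>y. F y * h y \<partial>?M"] abs_Re_le_cmod[of "\<integral>y. F y * h y \<partial>?M"]
    unfolding J_def[symmetric] Y_def[symmetric] by linarith+
qed

end

end

text \<open>The analysis is over at this point and only real numbers remain. \<open>G\<close>,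
  \<open>A\<close>, \<open>B\<close>, \<open>X\<close> are the norms of g,
  \<open>\<Delta>\<^sub>k\<close> g, g' and F, and \<open>W\<close> is the integral of |\<eta>|
  |g|^2. All powers of \<open>r\<close> cancel, leaving P G^2 \<le> 16 e^2 Q G^2 with P = c1
  (\<kappa> / L)^m and Q as defined in the proof, against the choice of \<open>e\<close>.\<close>

lemma resolvent_scaling_contradiction:
  fixes L c1 \<kappa> e r T G A B W X N C k \<nu> \<delta> :: real and m :: nat
  assumes pos: "L > 0" "c1 > 0" "\<kappa> > 0" "e > 0" "e \<le> 1" "r > 0" "r \<le> 1" "T > 0"
    and nn: "G \<ge> 0" "A \<ge> 0" "B \<ge> 0" "W \<ge> 0" "X \<ge> 0" "N \<ge> 0" "C \<ge> 0"
    and eqs: "\<delta> = \<kappa> * r" "\<nu> = T * r ^ 4" "k * r ^ m = T"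
    and \<kappa>: "4 * pi * N * \<kappa> * (1 / L + 2) \<le> 1 / 2"
    and e: "16 * e\<^sup>2 * (1 + 12 * N / \<kappa> + C / \<kappa>\<^sup>2) < c1 * (\<kappa> / L) ^ m"
    and X: "X < e ^ 4 * T * G"
    and h1: "\<nu> * A\<^sup>2 \<le> X * G" and h2: "B\<^sup>2 \<le> A * G"
    and h3: "k * (c1 * (\<delta> / L) ^ m) * W \<le> X * G + \<nu> * (A * (2 * (6 * N / \<delta>) * B + C / \<delta>\<^sup>2 * G))"
    and h4: "G\<^sup>2 \<le> 8 * W + 2 * (G\<^sup>2 / L + 2 * G * B) * (2 * pi * N * \<delta>)"
  shows False
proof -
  have G: "G > 0"
    using X nn pos by (metis mult_zero_right not_less order_le_less)
  have XG: "X * G \<le> e ^ 4 * T * G\<^sup>2"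
    using X G by (simp add: power2_eq_square)
  have A: "A \<le> e\<^sup>2 * G / r\<^sup>2"
  proof (rule power2_le_imp_le)
    have "T * r ^ 4 * A\<^sup>2 \<le> T * (e ^ 4 * G\<^sup>2)"
      using h1 XG by (simp add: eqs mult_ac)
    then have "r ^ 4 * A\<^sup>2 \<le> e ^ 4 * G\<^sup>2"
      using pos by (simp add: mult.assoc)
    then show "A\<^sup>2 \<le> (e\<^sup>2 * G / r\<^sup>2)\<^sup>2"
      using pos by (simp add: power_divide power_mult_distrib pos_le_divide_eq mult.commute flip: power_mult)
  qed (use G in simp)
  have B: "B \<le> e * G / r"
  proof (rule power2_le_imp_le)
    have "B\<^sup>2 \<le> e\<^sup>2 * G / r\<^sup>2 * G"
      using h2 mult_right_mono[OF A, of G] G by simp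
    then show "B\<^sup>2 \<le> (e * G / r)\<^sup>2"
      by (simp add: power_divide power_mult_distrib power2_eq_square[of G])
  qed (use G pos in simp)
  \<comment> \<open>The factor \<open>r\<close> in \<delta> compensates the 1 / r in the bound for
    \<open>B\<close>. The smallness of \<kappa> then makes this term at most half of G^2, and it is
    absorbed on the left.\<close>
  have "2 * (G\<^sup>2 / L + 2 * G * B) * (2 * pi * N * \<delta>) \<le> G\<^sup>2 / 2"
  proof -
    have "B * r \<le> G"
    proof -
      have "B * r \<le> e * G"
        using B pos by (simp add: field_simps)
      also have "\<dots> \<le> 1 * G"
        using pos G by (intro mult_right_mono) auto
      finally show ?thesis by simp
    qed
    have "(G\<^sup>2 / L + 2 * G * B) * r = G\<^sup>2 / L * r + 2 * G * (B * r)"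
      by (simp add: algebra_simps)
    also have "\<dots> \<le> G\<^sup>2 / L * 1 + 2 * G * G"
      using pos G \<open>B * r \<le> G\<close> by (intro add_mono mult_left_mono) auto
    also have "\<dots> = G\<^sup>2 * (1 / L + 2)"
      by (simp add: power2_eq_square algebra_simps)
    finally have *: "(G\<^sup>2 / L + 2 * G * B) * r \<le> G\<^sup>2 * (1 / L + 2)" .
    have "2 * (G\<^sup>2 / L + 2 * G * B) * (2 * pi * N * \<delta>) = 4 * pi * N * \<kappa> * ((G\<^sup>2 / L + 2 * G * B) * r)"
      by (simp add: eqs)
    also have "\<dots> \<le> 4 * pi * N * \<kappa> * (G\<^sup>2 * (1 / L + 2))"
      using * nn pos by (intro mult_left_mono) auto
    also have "\<dots> = (4 * pi * N * \<kappa> * (1 / L + 2)) * G\<^sup>2"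
      by simp
    also have "\<dots> \<le> 1 / 2 * G\<^sup>2"
      using \<kappa> by (intro mult_right_mono) auto
    finally show ?thesis by simp
  qed
  then have W: "G\<^sup>2 \<le> 16 * W"
    using h4 by simp
  define Q where "Q = 1 + 12 * N / \<kappa> + C / \<kappa>\<^sup>2"
  define P where "P = c1 * (\<kappa> / L) ^ m"
  have P: "P > 0"
    using pos by (simp add: P_def)
  have "T * P * W = k * (c1 * (\<delta> / L) ^ m) * W"
    unfolding P_def eqs(1) eqs(3)[symmetric] by (simp add: power_divide power_mult_distrib)
  also have "\<dots> \<le> e ^ 4 * T * G\<^sup>2 + \<nu> * (A * (2 * (6 * N / \<delta>) * B + C / \<delta>\<^sup>2 * G))"
    using h3 XG by simp
  also have "\<nu> * (A * (2 * (6 * N / \<delta>) * B + C / \<delta>\<^sup>2 * G))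
      \<le> \<nu> * ((e\<^sup>2 * G / r\<^sup>2) * (2 * (6 * N / \<delta>) * (e * G / r) + C / \<delta>\<^sup>2 * G))"
    using A B nn pos G by (intro mult_left_mono mult_mono add_mono) (auto simp: eqs)
  \<comment> \<open>Two powers of \<open>r\<close> come from \<open>A\<close> and two more from each
    summand in the bracket; \<nu> = T r^4 cancels them all.\<close>
  also have "\<dots> = T * e\<^sup>2 * G\<^sup>2 * (12 * N * e / \<kappa> + C / \<kappa>\<^sup>2)"
    using pos by (simp add: eqs field_simps power2_eq_square power4_eq_xxxx)
  also have "\<dots> \<le> T * e\<^sup>2 * G\<^sup>2 * (12 * N / \<kappa> + C / \<kappa>\<^sup>2)"
  proof -
    have "12 * N * e \<le> 12 * N * 1"
      using pos nn by (intro mult_left_mono) auto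
    then show ?thesis
      using pos by (intro mult_left_mono add_mono divide_right_mono) auto
  qed
  also have "e ^ 4 * T * G\<^sup>2 + T * e\<^sup>2 * G\<^sup>2 * (12 * N / \<kappa> + C / \<kappa>\<^sup>2) \<le> T * (e\<^sup>2 * G\<^sup>2 * Q)"
  proof -
    have "e ^ 4 = e\<^sup>2 * e\<^sup>2"
      by (simp flip: power_add)
    also have "\<dots> \<le> e\<^sup>2 * 1"
      using pos by (intro mult_left_mono power_le_one) auto
    finally have "e ^ 4 * T * G\<^sup>2 \<le> e\<^sup>2 * T * G\<^sup>2"
      using pos by (intro mult_right_mono) auto
    then show ?thesis
      by (simp add: Q_def algebra_simps)
  qed
  finally have "T * (P * W) \<le> T * (e\<^sup>2 * G\<^sup>2 * Q)"
    by (simp add: mult.assoc)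
  then have PW: "P * W \<le> e\<^sup>2 * G\<^sup>2 * Q"
    using pos by simp
  have "P * G\<^sup>2 \<le> P * (16 * W)"
    using W P by (intro mult_left_mono) auto
  also have "\<dots> \<le> 16 * (e\<^sup>2 * G\<^sup>2 * Q)"
    using PW by simp
  also have "\<dots> = (16 * e\<^sup>2 * Q) * G\<^sup>2"
    by simp
  also have "\<dots> < P * G\<^sup>2"
    using e G by (intro mult_strict_right_mono) (auto simp: P_def Q_def)
  finally show False by simp
qed

text \<open>The order of quantifiers is the content: \<epsilon> = e^4 is fixed from the data of the
  hypothesis on \<open>u\<close> before \<nu>, \<open>k\<close>, the level \<open>l\<close> and
  \<open>g\<close> appear. Only \<delta>, the points and the cutoff depend on these.\<close>

lemma resolvent_bound_C4:
  fixes L c1 \<delta>0 :: real and u :: "real \<Rightarrow> real" and m N :: nat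
  assumes L: "L > 0" and c1: "c1 > 0" and \<delta>0: "\<delta>0 > 0"
    and isCont_u: "\<And>y. isCont u y" and per: "\<And>y. u (y + L) = u y"
    and far: "\<forall>lam::real. \<forall>\<delta>\<in>{0<..<\<delta>0}. \<exists>n\<le>N. \<exists>p :: nat \<Rightarrow> real.
           (\<forall>j\<in>{1..n}. p j \<in> {0..<L}) \<and>
           (\<forall>y\<in>{0..<L}. (\<forall>j\<in>{1..n}. circle_dist L y (p j) \<ge> \<delta>) \<longrightarrow>
              \<bar>u y - lam\<bar> \<ge> c1 * (\<delta> / L) ^ m)"
  obtains \<epsilon> where "\<epsilon> > 0"
    "\<And>\<nu> k l g. 0 < \<nu> \<Longrightarrow> k \<noteq> 0 \<Longrightarrow> \<nu> * inverse \<bar>k\<bar> \<le> 1 \<Longrightarrow> circle_C4 L g \<Longrightarrow>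
      \<epsilon> * \<nu> powr (real m / (real m + 4)) * \<bar>k\<bar> powr (4 / (real m + 4)) * circle_norm L (g 0)
       \<le> circle_norm L (\<lambda>y. complex_of_real \<nu> *
            (- (complex_of_real k)\<^sup>2 * (- (complex_of_real k)\<^sup>2 * g 0 y + g 2 y)
             + (- (complex_of_real k)\<^sup>2 * g 2 y + g 4 y))
           + \<i> * complex_of_real (k * (u y - l)) * g 0 y)"
proof -
  \<comment> \<open>The first entry keeps \<delta> = \<kappa> r below \<open>\<delta>0\<close> for
    all r \<le> 1. The second is the mass condition of the contradiction lemma; the added 1 keeps
    the denominator positive when N = 0.\<close>
  define \<kappa> where "\<kappa> = min (\<delta>0 / 2) (1 / (8 * pi * real N * (1 / L + 2) + 1))"
  have den: "8 * pi * real N * (1 / L + 2) \<ge> 0"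
    using L by simp
  have \<kappa>: "\<kappa> > 0" "\<kappa> < \<delta>0"
    using \<delta>0 den by (auto simp: \<kappa>_def min_less_iff_disj)
  have \<kappa>': "4 * pi * real N * \<kappa> * (1 / L + 2) \<le> 1 / 2"
  proof -
    have "8 * pi * real N * (1 / L + 2) * \<kappa> \<le> (8 * pi * real N * (1 / L + 2) + 1) * \<kappa>"
      using \<kappa> by (intro mult_right_mono) auto
    also have "\<dots> \<le> (8 * pi * real N * (1 / L + 2) + 1) * (1 / (8 * pi * real N * (1 / L + 2) + 1))"
      using den by (intro mult_left_mono) (auto simp: \<kappa>_def)
    also have "\<dots> = 1"
      using den by simp
    finally show ?thesis
      by (simp add: algebra_simps)
  qed
  define C where "C = 24 * (real N)\<^sup>2 + 24 * real N"
  define Q where "Q = 1 + 12 * real N / \<kappa> + C / \<kappa>\<^sup>2"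
  define P where "P = c1 * (\<kappa> / L) ^ m"
  have C: "C \<ge> 0"
    by (simp add: C_def)
  have Q: "Q > 0"
    using \<kappa> C by (simp add: Q_def add_pos_nonneg)
  have P: "P > 0"
    using \<kappa> c1 L by (simp add: P_def)
  \<comment> \<open>As e \<le> 1, the square of e is at most e, so a bound on e itself suffices; 32
    in place of 16 leaves P / 2 and makes the inequality strict.\<close>
  define e where "e = min 1 (P / (32 * Q))"
  have e: "e > 0" "e \<le> 1"
    using P Q by (auto simp: e_def)
  have e': "16 * e\<^sup>2 * Q < P"
  proof -
    have "e\<^sup>2 \<le> e * 1"
      unfolding power2_eq_square using e by (intro mult_left_mono) auto
    also have "\<dots> \<le> P / (32 * Q)"
      by (simp add: e_def)
    finally have "16 * e\<^sup>2 * Q \<le> 16 * (P / (32 * Q)) * Q"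
      using Q by (intro mult_right_mono mult_left_mono) auto
    also have "\<dots> < P"
      using P Q by simp
    finally show ?thesis .
  qed
  show ?thesis
  proof (rule that[of "e ^ 4"])
    show "e ^ 4 > 0"
      using e by simp
    fix \<nu> k l :: real and g :: "nat \<Rightarrow> real \<Rightarrow> complex"
    assume \<nu>: "0 < \<nu>" and k: "k \<noteq> 0" and \<nu>k: "\<nu> * inverse \<bar>k\<bar> \<le> 1" and C4: "circle_C4 L g"
    interpret circle_C4 L g by (rule C4)
    define D where "D = (\<lambda>y. - (complex_of_real k)\<^sup>2 * g 0 y + g 2 y)"
    define F where "F = (\<lambda>y. complex_of_real \<nu> *
            (- (complex_of_real k)\<^sup>2 * (- (complex_of_real k)\<^sup>2 * g 0 y + g 2 y)
             + (- (complex_of_real k)\<^sup>2 * g 2 y + g 4 y))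
           + \<i> * complex_of_real (k * (u y - l)) * g 0 y)"
    define T where "T = \<nu> powr (real m / (real m + 4)) * \<bar>k\<bar> powr (4 / (real m + 4))"
    \<comment> \<open>The power m + 4 of \<open>r\<close> is \<nu> / |k|, which is exactly |k| r^m =
      \<nu> / r^4. The common value is \<open>T\<close>, whence the exponents m / (m + 4) and 4 / (m
      + 4).\<close>
    define r where "r = (\<nu> / \<bar>k\<bar>) powr (1 / (real m + 4))"
    have r: "r > 0" "r \<le> 1"
      using \<nu> k \<nu>k by (auto simp: r_def divide_inverse intro!: powr_le1)
    have rpow: "r ^ j = \<nu> powr (real j / (real m + 4)) * \<bar>k\<bar> powr (- (real j / (real m + 4)))" for j
    proof -
      have "r ^ j = r powr real j"
        using r by (simp add: powr_realpow)
      also have "\<dots> = (\<nu> / \<bar>k\<bar>) powr (real j / (real m + 4))"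
        by (simp add: r_def powr_powr)
      also have "\<dots> = \<nu> powr (real j / (real m + 4)) / \<bar>k\<bar> powr (real j / (real m + 4))"
        by (rule powr_divide)
      finally show ?thesis
        by (simp add: powr_minus_divide)
    qed
    have Tk: "\<bar>k\<bar> * r ^ m = T"
    proof -
      have "\<bar>k\<bar> * r ^ m = \<nu> powr (real m / (real m + 4)) * (\<bar>k\<bar> powr 1 * \<bar>k\<bar> powr (- (real m / (real m + 4))))"
        using k by (simp add: rpow)
      also have "\<bar>k\<bar> powr 1 * \<bar>k\<bar> powr (- (real m / (real m + 4))) = \<bar>k\<bar> powr (4 / (real m + 4))"
        by (subst powr_add[symmetric]) (simp add: field_simps)
      finally show ?thesis
        by (simp add: T_def)
    qed
    have T\<nu>: "\<nu> = T * r ^ 4"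
    proof -
      have "T * r ^ 4 = (\<nu> powr (real m / (real m + 4)) * \<nu> powr (4 / (real m + 4))) *
          (\<bar>k\<bar> powr (4 / (real m + 4)) * \<bar>k\<bar> powr (- (4 / (real m + 4))))"
        by (simp add: T_def rpow)
      also have "\<bar>k\<bar> powr (4 / (real m + 4)) * \<bar>k\<bar> powr (- (4 / (real m + 4))) = 1"
        using k by (subst powr_add[symmetric]) simp
      also have "\<nu> powr (real m / (real m + 4)) * \<nu> powr (4 / (real m + 4)) = \<nu> powr 1"
        by (subst powr_add[symmetric]) (simp add: add_divide_distrib[symmetric] add_nonneg_pos)
      finally show ?thesis
        using \<nu> by simp
    qed
    have T: "T > 0"
      using \<nu> k by (simp add: T_def)
    define \<delta> where "\<delta> = \<kappa> * r"
    have \<delta>: "\<delta> > 0" "\<delta> < \<delta>0"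
    proof -
      show "\<delta> > 0"
        using \<kappa> r by (simp add: \<delta>_def)
      have "\<delta> \<le> \<kappa> * 1"
        unfolding \<delta>_def using \<kappa> r by (intro mult_left_mono) auto
      then show "\<delta> < \<delta>0"
        using \<kappa> by simp
    qed
    define c where "c = c1 * (\<delta> / L) ^ m"
    have c: "c > 0"
      using c1 \<delta> L by (simp add: c_def)
    obtain n p where n: "n \<le> N"
      and np: "\<And>y. y \<in> {0..<L} \<Longrightarrow> (\<And>j. j \<in> {1..n} \<Longrightarrow> circle_dist L y (p j) \<ge> \<delta>) \<Longrightarrow> \<bar>u y - l\<bar> \<ge> c"
      using far \<delta> unfolding c_def by (metis greaterThanLessThan_iff)
    obtain \<eta> \<eta>' \<eta>'' K :: "real \<Rightarrow> real" where
      \<eta>: "\<And>y. (\<eta> has_real_derivative \<eta>' y) (at y)" "\<And>y. (\<eta>' has_real_derivative \<eta>'' y) (at y)"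
      "\<And>y. isCont \<eta>'' y" "\<eta> L = \<eta> 0" "\<eta>' L = \<eta>' 0"
      and bounds: "\<And>y. \<bar>\<eta> y\<bar> \<le> 1" "\<And>y. \<bar>\<eta>' y\<bar> \<le> 6 * real N / \<delta>"
      "\<And>y. \<bar>\<eta>'' y\<bar> \<le> C / \<delta>\<^sup>2"
      and coercive: "\<And>y. c * \<bar>\<eta> y\<bar> \<le> \<eta> y * (u y - l)"
      and K: "\<And>y. 1 \<le> 8 * \<bar>\<eta> y\<bar> + 2 * K y"
      "\<And>y. K y \<ge> 0" "\<And>y. isCont K y"
      "(\<integral>y. K y \<partial>circle_measure L) \<le> 2 * pi * real N * \<delta>"
      using cutoff_exists[OF L \<delta>(1) n c isCont_u per np] unfolding C_def by blast
    have cont_u: "continuous_on UNIV u" and cont_\<eta>: "continuous_on UNIV \<eta>"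
      using isCont_u \<eta>(1) by (auto intro!: continuous_at_imp_continuous_on intro: DERIV_isCont)
    have contv: "continuous_on UNIV (\<lambda>y. k * (u y - l))"
      by (intro continuous_intros cont_u)
    define W where "W = (\<integral>y. \<bar>\<eta> y\<bar> * (cmod (g 0 y))\<^sup>2 \<partial>circle_measure L)"
    have W: "W \<ge> 0"
      by (simp add: W_def)
    have h1: "\<nu> * (circle_norm L D)\<^sup>2 \<le> circle_norm L F * circle_norm L (g 0)"
    proof -
      have "\<nu> * (\<integral>y. 1 * (cmod (D y))\<^sup>2 \<partial>circle_measure L) \<le> circle_norm L F * circle_norm L (g 0)
          + \<nu> * (circle_norm L D * (2 * 0 * circle_norm L (g 1) + 0 * circle_norm L (g 0)))"
        unfolding D_def F_def
        by (rule cutoff_energy(2)[where \<eta> = "\<lambda>_. 1" and \<eta>' = "\<lambda>_. 0" and \<eta>'' = "\<lambda>_. 0", OF less_imp_le[OF \<nu>] contv]) auto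
      then show ?thesis
        by (simp add: circle_norm_power2)
    qed
    have h2: "(circle_norm L (g 1))\<^sup>2 \<le> circle_norm L D * circle_norm L (g 0)"
      unfolding D_def by (rule norm_deriv_le)
    have h3: "\<bar>k\<bar> * c * W \<le> circle_norm L F * circle_norm L (g 0)
      + \<nu> * (circle_norm L D * (2 * (6 * real N / \<delta>) * circle_norm L (g 1) + C / \<delta>\<^sup>2 * circle_norm L (g 0)))"
    proof -
      have int: "integrable (circle_measure L) (\<lambda>y. \<bar>\<eta> y\<bar> * (cmod (g 0 y))\<^sup>2)"
        "integrable (circle_measure L) (\<lambda>y. \<eta> y * (u y - l) * (cmod (g 0 y))\<^sup>2)"
        by (intro integrable_continuous_circle continuous_intros cont_\<eta> cont_u conts)+
      have "c * W = (\<integral>y. c * (\<bar>\<eta> y\<bar> * (cmod (g 0 y))\<^sup>2) \<partial>circle_measure L)"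
        by (simp add: W_def)
      also have "\<dots> \<le> (\<integral>y. \<eta> y * (u y - l) * (cmod (g 0 y))\<^sup>2 \<partial>circle_measure L)"
      proof (rule integral_mono)
        fix y
        show "c * (\<bar>\<eta> y\<bar> * (cmod (g 0 y))\<^sup>2) \<le> \<eta> y * (u y - l) * (cmod (g 0 y))\<^sup>2"
          using mult_right_mono[OF coercive[of y], of "(cmod (g 0 y))\<^sup>2"] by (simp add: mult.assoc)
      qed (use int in auto)
      finally have "\<bar>k\<bar> * c * W \<le> \<bar>k\<bar> * \<bar>\<integral>y. \<eta> y * (u y - l) * (cmod (g 0 y))\<^sup>2 \<partial>circle_measure L\<bar>"
        by (simp add: mult.assoc mult_left_mono)
      also have "\<dots> = \<bar>\<integral>y. k * (\<eta> y * (u y - l) * (cmod (g 0 y))\<^sup>2) \<partial>circle_measure L\<bar>"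
        by (simp add: abs_mult)
      also have "\<dots> = \<bar>\<integral>y. \<eta> y * (k * (u y - l)) * (cmod (g 0 y))\<^sup>2 \<partial>circle_measure L\<bar>"
        by (simp add: mult_ac)
      also have "\<dots> \<le> circle_norm L F * circle_norm L (g 0)
          + \<nu> * (circle_norm L D * (2 * (6 * real N / \<delta>) * circle_norm L (g 1) + C / \<delta>\<^sup>2 * circle_norm L (g 0)))"
        unfolding D_def F_def by (rule cutoff_energy(1)[OF less_imp_le[OF \<nu>] contv \<eta> bounds])
      finally show ?thesis .
    qed
    have h4: "(circle_norm L (g 0))\<^sup>2 \<le> 8 * W
      + 2 * ((circle_norm L (g 0))\<^sup>2 / L + 2 * circle_norm L (g 0) * circle_norm L (g 1)) * (2 * pi * real N * \<delta>)"
      unfolding W_def by (rule integral_square_le_cutoff[OF DERIV_isCont[OF \<eta>(1)] K(3,2,1,4)])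
    have "e ^ 4 * T * circle_norm L (g 0) \<le> circle_norm L F"
    proof (rule ccontr)
      assume "\<not> ?thesis"
      then have X: "circle_norm L F < e ^ 4 * T * circle_norm L (g 0)"
        by simp
      show False
        using resolvent_scaling_contradiction[OF L c1 \<kappa>(1) e r T, of "circle_norm L (g 0)" "circle_norm L D"
            "circle_norm L (g 1)" W "circle_norm L F" "real N" C \<delta> \<nu> "\<bar>k\<bar>" m]
          W C \<delta>_def T\<nu> Tk \<kappa>' e'[unfolded P_def Q_def] X h1 h2 h3[unfolded c_def] h4 by simp
    qed
    then show "e ^ 4 * \<nu> powr (real m / (real m + 4)) * \<bar>k\<bar> powr (4 / (real m + 4)) * circle_norm L (g 0)
       \<le> circle_norm L (\<lambda>y. complex_of_real \<nu> *
            (- (complex_of_real k)\<^sup>2 * (- (complex_of_real k)\<^sup>2 * g 0 y + g 2 y)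
             + (- (complex_of_real k)\<^sup>2 * g 2 y + g 4 y))
           + \<i> * complex_of_real (k * (u y - l)) * g 0 y)"
      unfolding F_def T_def by (simp add: mult.assoc)
  qed
qed

section \<open>Fourier series\<close>

definition fourier_mode :: "real \<Rightarrow> int \<Rightarrow> real \<Rightarrow> complex" where
  "fourier_mode L n y = cis (2 * pi * of_int n / L * y)"

definition fourier_coeff :: "real \<Rightarrow> (real \<Rightarrow> complex) \<Rightarrow> int \<Rightarrow> complex" where
  "fourier_coeff L h n = (\<integral>y. h y * fourier_mode L (- n) y \<partial>circle_measure L) / complex_of_real L"

definition fourier_sum :: "real \<Rightarrow> (real \<Rightarrow> complex) \<Rightarrow> nat \<Rightarrow> real \<Rightarrow> complex" where
  "fourier_sum L h M y = (\<Sum>n\<in>{- int M..int M}. fourier_coeff L h n * fourier_mode L n y)"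

text \<open>An inductive set makes closure under products, as the Stone-Weierstrass theorem asks
  for, a plain induction. Degree and coefficients are recovered afterwards in
  \<open>trig_poly_coeffs\<close>.\<close>

inductive trig_poly :: "real \<Rightarrow> (real \<Rightarrow> complex) \<Rightarrow> bool" for L where
  mode: "trig_poly L (\<lambda>y. c * fourier_mode L n y)"
| add: "trig_poly L f \<Longrightarrow> trig_poly L g \<Longrightarrow> trig_poly L (\<lambda>y. f y + g y)"

lemma fourier_mode_0 [simp]: "fourier_mode L 0 y = 1"
  by (simp add: fourier_mode_def)

lemma fourier_mode_add: "fourier_mode L (n + j) y = fourier_mode L n y * fourier_mode L j y"
  by (simp add: fourier_mode_def cis_mult algebra_simps add_divide_distrib)

lemma cnj_fourier_mode [simp]: "cnj (fourier_mode L n y) = fourier_mode L (- n) y"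
  by (simp add: fourier_mode_def cis_cnj)

lemma fourier_mode_deriv:
  "(fourier_mode L n has_vector_derivative
     \<i> * complex_of_real (2 * pi * of_int n / L) * fourier_mode L n y) (at y)"
proof -
  define c where "c = \<i> * complex_of_real (2 * pi * of_int n / L)"
  have "((\<lambda>y. exp (c * complex_of_real y)) has_vector_derivative c * exp (c * complex_of_real y)) (at y)"
    by (rule has_vector_derivative_real_field) (auto intro!: derivative_eq_intros)
  moreover have "fourier_mode L n = (\<lambda>y. exp (c * complex_of_real y))"
    unfolding fourier_mode_def[abs_def] cis_conv_exp c_def by (simp only: of_real_mult mult.assoc)
  ultimately show ?thesis
    by (simp only: c_def)
qed

lemma continuous_fourier_mode: "continuous_on UNIV (fourier_mode L n)"
  using fourier_mode_deriv by (meson continuous_at_imp_continuous_on has_vector_derivative_continuous)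

lemma fourier_mode_period:
  assumes "L \<noteq> 0"
  shows "fourier_mode L n L = 1"
proof -
  have "fourier_mode L n L = cis (2 * pi * of_int n)"
    using assms by (simp add: fourier_mode_def)
  then show ?thesis
    by (simp add: cis_multiple_2pi)
qed

lemma circle_L2_fourier_mode: "fourier_mode L n \<in> circle_L2 L"
  by (intro circle_L2_continuous continuous_fourier_mode)

lemma integral_fourier_mode:
  assumes "L > 0"
  shows "(\<integral>y. fourier_mode L n y \<partial>circle_measure L) = (if n = 0 then complex_of_real L else 0)"
proof (cases "n = 0")
  case True
  then show ?thesis
    using assms by (simp add: measure_restrict_space scaleR_conv_of_real)
next
  case False
  have "(\<integral>y. \<i> * complex_of_real (2 * pi * of_int n / L) * fourier_mode L n y \<partial>circle_measure L)
      = fourier_mode L n L - fourier_mode L n 0"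
    using assms by (intro integral_circle_deriv fourier_mode_deriv continuous_intros continuous_fourier_mode) auto
  also have "\<dots> = 0"
    using assms by (simp add: fourier_mode_period) (simp add: fourier_mode_def)
  finally show ?thesis
    using False assms by simp
qed

section \<open>Best approximation by Fourier partial sums\<close>

lemma circle_norm_le_add_orthogonal:
  assumes f: "f \<in> circle_L2 L" and p: "p \<in> circle_L2 L"
    and orth: "(\<integral>y. f y * cnj (p y) \<partial>circle_measure L) = 0"
  shows "circle_norm L f \<le> circle_norm L (\<lambda>y. f y + p y)"
proof (rule power2_le_imp_le)
  let ?M = "circle_measure L"
  have "(\<lambda>y. cnj (p y)) \<in> circle_L2 L"
    using p unfolding circle_L2_def by (auto intro!: measurable_compose[of p _ _ cnj] borel_measurable_continuous_onI continuous_intros)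
  then have int: "integrable ?M (\<lambda>y. f y * cnj (p y))"
    by (rule circle_L2_mult_integrable[OF f])
  note intRe = integrable_Re[OF int]
  have Re0: "(\<integral>y. Re (f y * cnj (p y)) \<partial>?M) = 0"
    using orth integral_Re[OF int] by simp
  have "(circle_norm L f)\<^sup>2 \<le> (\<integral>y. (cmod (f y))\<^sup>2 + (cmod (p y))\<^sup>2 + 2 * Re (f y * cnj (p y)) \<partial>?M)"
    using f p Re0 intRe
    by (simp add: circle_L2_integrable circle_norm_power2 del: times_complex.simps complex_cnj)
  also have "\<dots> = (circle_norm L (\<lambda>y. f y + p y))\<^sup>2"
    unfolding circle_norm_power2
    by (intro Bochner_Integration.integral_cong refl)
      (simp add: cmod_power2, simp add: power2_eq_square algebra_simps)
  finally show "(circle_norm L f)\<^sup>2 \<le> (circle_norm L (\<lambda>y. f y + p y))\<^sup>2" .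
qed simp

lemma continuous_fourier_sum: "continuous_on UNIV (fourier_sum L h M)"
  unfolding fourier_sum_def by (intro continuous_intros continuous_fourier_mode)

lemma circle_L2_fourier_sum: "fourier_sum L h M \<in> circle_L2 L"
  by (intro circle_L2_continuous continuous_fourier_sum)

lemma integral_fourier_residual:
  assumes L: "L > 0" and h: "h \<in> circle_L2 L" and j: "\<bar>j\<bar> \<le> int M"
  shows "(\<integral>y. (h y - fourier_sum L h M y) * fourier_mode L (- j) y \<partial>circle_measure L) = 0"
proof -
  let ?M = "circle_measure L"
  have "(\<integral>y. (h y - fourier_sum L h M y) * fourier_mode L (- j) y \<partial>?M)
      = (\<integral>y. h y * fourier_mode L (- j) y - fourier_sum L h M y * fourier_mode L (- j) y \<partial>?M)"
    by (simp add: algebra_simps)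
  also have "\<dots> = (\<integral>y. h y * fourier_mode L (- j) y \<partial>?M)
      - (\<integral>y. fourier_sum L h M y * fourier_mode L (- j) y \<partial>?M)"
    by (intro Bochner_Integration.integral_diff circle_L2_mult_integrable h circle_L2_fourier_sum
        circle_L2_fourier_mode)
  also have "(\<integral>y. fourier_sum L h M y * fourier_mode L (- j) y \<partial>?M)
      = (\<integral>y. (\<Sum>n\<in>{- int M..int M}. fourier_coeff L h n * fourier_mode L (n - j) y) \<partial>?M)"
    by (simp add: fourier_sum_def sum_distrib_right fourier_mode_add[of L _ "- j", simplified] mult.assoc)
  also have "\<dots> = (\<Sum>n\<in>{- int M..int M}. \<integral>y. fourier_coeff L h n * fourier_mode L (n - j) y \<partial>?M)"
    by (intro Bochner_Integration.integral_sum integrable_continuous_circle continuous_intros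
        continuous_fourier_mode)
  also have "\<dots> = (\<Sum>n\<in>{- int M..int M}. if n = j then fourier_coeff L h n * complex_of_real L else 0)"
    using L by (intro sum.cong refl) (simp add: integral_fourier_mode)
  also have "\<dots> = fourier_coeff L h j * complex_of_real L"
    using j by (subst sum.delta) auto
  finally show ?thesis
    using L by (simp add: fourier_coeff_def)
qed

text \<open>The residual of the partial sum is orthogonal to all modes up to degree
  \<open>M\<close>, and the two approximants differ by a combination of these modes. Adding an
  orthogonal function cannot decrease the norm.\<close>

lemma fourier_sum_best_approximation:
  assumes L: "L > 0" and h: "h \<in> circle_L2 L"
  shows "circle_norm L (\<lambda>y. h y - fourier_sum L h M y)
    \<le> circle_norm L (\<lambda>y. h y - (\<Sum>n\<in>{- int M..int M}. a n * fourier_mode L n y))"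
proof -
  let ?M = "circle_measure L"
  define p where "p = (\<lambda>y. \<Sum>n\<in>{- int M..int M}. (fourier_coeff L h n - a n) * fourier_mode L n y)"
  have p: "p \<in> circle_L2 L"
    unfolding p_def by (intro circle_L2_continuous continuous_intros continuous_fourier_mode)
  have res: "(\<lambda>y. h y - fourier_sum L h M y) \<in> circle_L2 L"
    by (intro circle_L2_diff h circle_L2_fourier_sum)
  have "(\<integral>y. (h y - fourier_sum L h M y) * cnj (p y) \<partial>?M)
      = (\<integral>y. (\<Sum>n\<in>{- int M..int M}. cnj (fourier_coeff L h n - a n) *
           ((h y - fourier_sum L h M y) * fourier_mode L (- n) y)) \<partial>?M)"
    by (simp add: p_def sum_distrib_left mult_ac)
  also have "\<dots> = (\<Sum>n\<in>{- int M..int M}. \<integral>y. cnj (fourier_coeff L h n - a n) *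
           ((h y - fourier_sum L h M y) * fourier_mode L (- n) y) \<partial>?M)"
    by (intro Bochner_Integration.integral_sum Bochner_Integration.integrable_mult_right
        circle_L2_mult_integrable res circle_L2_fourier_mode)
  also have "\<dots> = (\<Sum>n\<in>{- int M..int M}. cnj (fourier_coeff L h n - a n) * 0)"
  proof (intro sum.cong refl)
    fix n assume "n \<in> {- int M..int M}"
    then have "(\<integral>y. (h y - fourier_sum L h M y) * fourier_mode L (- n) y \<partial>?M) = 0"
      by (intro integral_fourier_residual L h) auto
    then show "(\<integral>y. cnj (fourier_coeff L h n - a n) * ((h y - fourier_sum L h M y) * fourier_mode L (- n) y) \<partial>?M)
        = cnj (fourier_coeff L h n - a n) * 0"
      by simp
  qed
  finally have "circle_norm L (\<lambda>y. h y - fourier_sum L h M y) \<le> circle_norm L (\<lambda>y. h y - fourier_sum L h M y + p y)"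
    by (intro circle_norm_le_add_orthogonal res p) simp
  also have "(\<lambda>y. h y - fourier_sum L h M y + p y) = (\<lambda>y. h y - (\<Sum>n\<in>{- int M..int M}. a n * fourier_mode L n y))"
    by (simp add: fun_eq_iff p_def fourier_sum_def left_diff_distrib sum_subtractf)
  finally show ?thesis .
qed

text \<open>The coefficients are padded with zeros, so that one family \<open>a\<close> represents
  \<open>f\<close> at every degree from \<open>M\<close> on. This allows a comparison with all later
  partial sums.\<close>

lemma trig_poly_coeffs:
  assumes "trig_poly L f"
  obtains M :: nat and a where
    "\<And>M' y. M' \<ge> M \<Longrightarrow> f y = (\<Sum>n\<in>{- int M'..int M'}. a n * fourier_mode L n y)"
proof -
  have "\<exists>(M::nat) a. \<forall>M'\<ge>M. \<forall>y. f y = (\<Sum>n\<in>{- int M'..int M'}. a n * fourier_mode L n y)"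
    using assms
  proof induction
    case (mode c n)
    show ?case
    proof (intro exI allI impI)
      fix M' :: nat and y assume "nat \<bar>n\<bar> \<le> M'"
      then have "n \<in> {- int M'..int M'}"
        by auto
      then show "c * fourier_mode L n y = (\<Sum>j\<in>{- int M'..int M'}. (if j = n then c else 0) * fourier_mode L j y)"
        by (simp add: if_distrib[of "\<lambda>x. x * _"] sum.delta' cong: if_cong)
    qed
  next
    case (add f g)
    then obtain M M' :: nat and a b where
      "\<forall>K\<ge>M. \<forall>y. f y = (\<Sum>n\<in>{- int K..int K}. a n * fourier_mode L n y)"
      "\<forall>K\<ge>M'. \<forall>y. g y = (\<Sum>n\<in>{- int K..int K}. b n * fourier_mode L n y)"
      by blast
    then show ?case
      by (intro exI[of _ "max M M'"] exI[of _ "\<lambda>n. a n + b n"])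
        (auto simp: distrib_right sum.distrib)
  qed
  then show ?thesis
    using that by blast
qed

section \<open>Density of trigonometric polynomials in L^2\<close>

lemma trig_poly_const: "trig_poly L (\<lambda>y. c)"
  using trig_poly.mode[of L c 0] by simp

lemma trig_poly_mult_mode: "trig_poly L f \<Longrightarrow> trig_poly L (\<lambda>y. f y * (c * fourier_mode L n y))"
proof (induction rule: trig_poly.induct)
  case (mode d j)
  show ?case
    using trig_poly.mode[of L "d * c" "j + n"] by (simp add: fourier_mode_add mult_ac)
next
  case (add f g)
  then show ?case
    by (simp add: distrib_right trig_poly.add)
qed

lemma trig_poly_mult:
  assumes "trig_poly L f" "trig_poly L g"
  shows "trig_poly L (\<lambda>y. f y * g y)"
  using assms(2)
proof (induction rule: trig_poly.induct)
  case (mode c n)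
  show ?case
    using assms(1) by (rule trig_poly_mult_mode)
next
  case (add g1 g2)
  then show ?case
    by (simp add: distrib_left trig_poly.add)
qed

lemma trig_poly_cmult: "trig_poly L f \<Longrightarrow> trig_poly L (\<lambda>y. c * f y)"
  using trig_poly_mult[OF trig_poly_const] .

lemma continuous_trig_poly: "trig_poly L f \<Longrightarrow> continuous_on UNIV f"
  by (induction rule: trig_poly.induct) (intro continuous_intros continuous_fourier_mode; assumption)+

lemma trig_poly_cos_sin:
  "trig_poly L (\<lambda>y. complex_of_real (Re (fourier_mode L 1 y)))"
  "trig_poly L (\<lambda>y. complex_of_real (Im (fourier_mode L 1 y)))"
proof -
  have "complex_of_real (Re z) = 1 / 2 * z + 1 / 2 * cnj z"
    "complex_of_real (Im z) = - \<i> / 2 * z + \<i> / 2 * cnj z" for z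
    by (simp_all add: complex_eq_iff)
  from this[of "fourier_mode L 1 y" for y] show
    "trig_poly L (\<lambda>y. complex_of_real (Re (fourier_mode L 1 y)))"
    "trig_poly L (\<lambda>y. complex_of_real (Im (fourier_mode L 1 y)))"
    by (simp_all only: cnj_fourier_mode) (intro trig_poly.add trig_poly.mode)+
qed

text \<open>The interval is wrapped onto the unit circle \<open>S\<close> by the first mode
  \<open>E\<close>, and Stone-Weierstrass is applied on \<open>S\<close>, where real and imaginary
  part separate points; on the interval itself trigonometric polynomials do not separate the
  endpoints.\<close>

lemma trig_poly_dense_real:
  fixes f :: "real \<Rightarrow> real"
  assumes L: "L > 0" and f: "continuous_on {0..L} f" "f 0 = f L" and e: "e > 0"
  obtains p where "trig_poly L p" "\<And>y. y \<in> {0..L} \<Longrightarrow> cmod (complex_of_real (f y) - p y) < e"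
proof -
  define E where "E = fourier_mode L 1"
  define S where "S = E ` {0..L}"
  have E: "continuous_on {0..L} E"
    unfolding E_def using continuous_fourier_mode by (rule continuous_on_subset) simp
  define F where "F = (\<lambda>z. f (L / (2 * pi) * Arg2pi z))"
  \<comment> \<open>\<open>Arg2pi\<close> takes values in [0, 2 pi), so at t = L it returns 0; there
    the identity rests on f 0 = f L.\<close>
  have FE: "F (E t) = f t" if "t \<in> {0..L}" for t
  proof (cases "t = L")
    case True
    then show ?thesis
      using L f(2) by (simp add: F_def E_def fourier_mode_period Arg2pi_of_real[of 1, simplified])
  next
    case False
    then have "2 * pi / L * t < 2 * pi"
      using that L by (simp add: field_simps)
    then have "Arg2pi (E t) = 2 * pi / L * t"
      using that L by (intro Arg2pi_unique[of 1]) (auto simp: E_def fourier_mode_def cis_conv_exp)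
    then show ?thesis
      using L by (simp add: F_def)
  qed
  \<comment> \<open>\<open>Arg2pi\<close> jumps at 1, so continuity of \<open>F\<close> is not
    inherited from it. Instead \<open>E\<close> is a quotient map, being continuous on a compact
    interval, and \<open>F\<close> after \<open>E\<close> is the continuous
    \<open>f\<close>.\<close>
  have contF: "continuous_on S F"
    unfolding continuous_openin_preimage_eq
  proof (intro allI impI)
    fix C :: "real set" assume C: "open C"
    have "{0..L} \<inter> E -` (S \<inter> F -` C) = {0..L} \<inter> f -` C"
      using FE imageI[of _ "{0..L}" E, folded S_def] by (auto simp del: atLeastAtMost_iff)
    then have "openin (top_of_set {0..L}) ({0..L} \<inter> E -` (S \<inter> F -` C))"
      using f(1) C by (simp add: continuous_openin_preimage_gen)
    then show "openin (top_of_set S) (S \<inter> F -` C)"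
      by (subst Abstract_Topology_2.continuous_imp_quotient_map[OF E S_def[symmetric] compact_Icc, symmetric]) auto
  qed
  define P where "P = (\<lambda>\<phi> :: complex \<Rightarrow> real. continuous_on S \<phi> \<and> trig_poly L (\<lambda>y. complex_of_real (\<phi> (E y))))"
  have "\<exists>\<phi>. P \<phi> \<and> (\<forall>z\<in>S. \<bar>F z - \<phi> z\<bar> < e)"
  proof (rule Stone_Weierstrass_HOL)
    show "compact S"
      unfolding S_def using E by (intro compact_continuous_image) auto
    show "P (\<lambda>x. c)" for c
      by (simp add: P_def trig_poly_const)
    show "continuous_on S \<phi>" if "P \<phi>" for \<phi>
      using that by (simp add: P_def)
    show "P (\<lambda>x. \<phi> x + \<psi> x)" if "P \<phi> \<and> P \<psi>" for \<phi> \<psi>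
      using that by (auto simp: P_def trig_poly.add intro: continuous_intros)
    show "P (\<lambda>x. \<phi> x * \<psi> x)" if "P \<phi> \<and> P \<psi>" for \<phi> \<psi>
      using that by (auto simp: P_def trig_poly_mult intro: continuous_intros)
    have "P Re" "P Im"
      by (simp_all add: P_def E_def trig_poly_cos_sin continuous_on_Re continuous_on_Im continuous_on_id)
    then show "\<exists>\<phi>. P \<phi> \<and> \<phi> x \<noteq> \<phi> y" if "x \<in> S \<and> y \<in> S \<and> x \<noteq> y" for x y
      using that by (metis complex_eqI)
  qed (use contF e in auto)
  then obtain \<phi> where \<phi>: "P \<phi>" "\<And>z. z \<in> S \<Longrightarrow> \<bar>F z - \<phi> z\<bar> < e"
    by blast
  show ?thesis
  proof (rule that)
    show "trig_poly L (\<lambda>y. complex_of_real (\<phi> (E y)))"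
      using \<phi>(1) by (simp add: P_def)
    fix y assume y: "y \<in> {0..L}"
    then have "\<bar>f y - \<phi> (E y)\<bar> < e"
      using \<phi>(2)[of "E y"] FE[OF y] by (simp add: S_def)
    then show "cmod (complex_of_real (f y) - complex_of_real (\<phi> (E y))) < e"
      by (simp flip: of_real_diff)
  qed
qed

lemma trig_poly_dense_continuous:
  fixes f :: "real \<Rightarrow> complex"
  assumes L: "L > 0" and f: "continuous_on {0..L} f" "f 0 = f L" and e: "e > 0"
  obtains p where "trig_poly L p" "\<And>y. y \<in> {0..L} \<Longrightarrow> cmod (f y - p y) < e"
proof -
  obtain p where p: "trig_poly L p" "\<And>y. y \<in> {0..L} \<Longrightarrow> cmod (complex_of_real (Re (f y)) - p y) < e / 2"
    using trig_poly_dense_real[OF L, of "\<lambda>y. Re (f y)" "e / 2"] f e by (auto intro: continuous_intros)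
  obtain q where q: "trig_poly L q" "\<And>y. y \<in> {0..L} \<Longrightarrow> cmod (complex_of_real (Im (f y)) - q y) < e / 2"
    using trig_poly_dense_real[OF L, of "\<lambda>y. Im (f y)" "e / 2"] f e by (auto intro: continuous_intros)
  show ?thesis
  proof (rule that)
    show "trig_poly L (\<lambda>y. p y + \<i> * q y)"
      using p(1) q(1) by (intro trig_poly.add trig_poly_cmult)
    fix y assume y: "y \<in> {0..L}"
    have "f y - (p y + \<i> * q y) = (complex_of_real (Re (f y)) - p y) + \<i> * (complex_of_real (Im (f y)) - q y)"
      by (subst complex_eq[of "f y"]) (simp add: algebra_simps)
    also have "cmod \<dots> \<le> cmod (complex_of_real (Re (f y)) - p y) + cmod (complex_of_real (Im (f y)) - q y)"
      by (rule order_trans[OF norm_triangle_ineq]) (simp add: norm_mult)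
    also have "\<dots> < e"
      using p(2)[OF y] q(2)[OF y] by simp
    finally show "cmod (f y - (p y + \<i> * q y)) < e" .
  qed
qed

lemma circle_norm_tendsto_0:
  assumes f: "\<And>n::nat. f n \<in> borel_measurable (circle_measure L)"
    and lim: "AE y in circle_measure L. (\<lambda>n. f n y) \<longlonglongrightarrow> 0"
    and w: "integrable (circle_measure L) (\<lambda>y. (w y)\<^sup>2)"
    and bound: "\<And>n y. y \<in> {0..<L} \<Longrightarrow> cmod (f n y) \<le> w y"
  shows "(\<lambda>n. circle_norm L (f n)) \<longlonglongrightarrow> 0"
proof -
  note [measurable] = f
  have "(\<lambda>n. \<integral>y. (cmod (f n y))\<^sup>2 \<partial>circle_measure L) \<longlonglongrightarrow> (\<integral>y. 0 \<partial>circle_measure L)"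
  proof (rule integral_dominated_convergence[OF _ _ w])
    show "AE y in circle_measure L. (\<lambda>n. (cmod (f n y))\<^sup>2) \<longlonglongrightarrow> 0"
      using lim by eventually_elim (auto intro!: tendsto_eq_intros)
    show "AE y in circle_measure L. norm ((cmod (f n y))\<^sup>2) \<le> (w y)\<^sup>2" for n
      using bound by (intro AE_I2) (auto intro!: power_mono)
  qed auto
  then show ?thesis
    unfolding circle_norm_def using tendsto_real_sqrt by fastforce
qed

text \<open>For R > 0 this is the radial retraction of the plane onto the closed disc of radius R;
  the maximum keeps the denominator away from 0. Being continuous and bounded, it prepares functions
  for dominated convergence.\<close>

definition clip :: "real \<Rightarrow> complex \<Rightarrow> complex" where
  "clip R z = complex_of_real (R / max R (cmod z)) * z"

lemma clip_eq: "R > 0 \<Longrightarrow> cmod z \<le> R \<Longrightarrow> clip R z = z"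
  by (simp add: clip_def)

lemma cmod_clip_le: "R > 0 \<Longrightarrow> cmod (clip R z) \<le> R"
  by (simp add: clip_def norm_mult norm_divide pos_divide_le_eq max_def)

lemma cmod_diff_clip_le:
  assumes "R > 0"
  shows "cmod (z - clip R z) \<le> cmod z"
proof -
  have "z - clip R z = complex_of_real (1 - R / max R (cmod z)) * z"
    by (simp add: clip_def algebra_simps)
  also have "cmod \<dots> = \<bar>1 - R / max R (cmod z)\<bar> * cmod z"
    by (simp only: norm_mult norm_of_real)
  also have "\<dots> \<le> 1 * cmod z"
    using assms by (intro mult_right_mono) (auto simp: abs_le_iff pos_divide_le_eq le_max_iff_disj)
  finally show ?thesis by simp
qed

lemma continuous_clip: "R > 0 \<Longrightarrow> continuous_on UNIV (clip R)"
  unfolding clip_def by (intro continuous_intros) (auto simp: max_def)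

lemma measurable_clip [measurable]:
  assumes "R > 0" and [measurable]: "h \<in> borel_measurable (circle_measure L)"
  shows "(\<lambda>y. clip R (h y)) \<in> borel_measurable (circle_measure L)"
  using assms borel_measurable_continuous_onI[OF continuous_clip[OF assms(1)]]
  by (blast intro: measurable_compose)

lemma circle_L2_clip:
  assumes "R > 0" "h \<in> borel_measurable (circle_measure L)"
  shows "(\<lambda>y. clip R (h y)) \<in> circle_L2 L"
  using circle_L2_mult_bounded[of "\<lambda>_. 1" L "\<lambda>y. clip R (h y)" R]
    measurable_clip[OF assms] cmod_clip_le[OF assms(1)] circle_L2_continuous[of "\<lambda>_. 1" L]
  by simp

lemma circle_L2_approx_clip:
  assumes h: "h \<in> circle_L2 L" and e: "e > 0"
  obtains R where "R > 0" "circle_norm L (\<lambda>y. h y - clip R (h y)) < e"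
proof -
  have "(\<lambda>n. circle_norm L (\<lambda>y. h y - clip (real (Suc n)) (h y))) \<longlonglongrightarrow> 0"
  proof (rule circle_norm_tendsto_0)
    show "(\<lambda>y. h y - clip (real (Suc n)) (h y)) \<in> borel_measurable (circle_measure L)" for n
      using circle_L2_measurable[OF h] by (intro borel_measurable_diff measurable_clip) auto
    have "(\<lambda>n. z - clip (real (Suc n)) z) \<longlonglongrightarrow> 0" for z
    proof (rule tendsto_eventually)
      obtain n0 :: nat where n0: "cmod z \<le> real n0"
        using real_arch_simple by blast
      show "\<forall>\<^sub>F n in sequentially. z - clip (real (Suc n)) z = 0"
        using eventually_ge_at_top[of n0] by eventually_elim (use n0 in \<open>simp add: clip_eq\<close>)
    qed
    then show "AE y in circle_measure L. (\<lambda>n. h y - clip (real (Suc n)) (h y)) \<longlonglongrightarrow> 0"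
      by simp
    show "integrable (circle_measure L) (\<lambda>y. (cmod (h y))\<^sup>2)"
      using h by (rule circle_L2_integrable)
  qed (intro cmod_diff_clip_le; simp)
  then have "\<forall>\<^sub>F n in sequentially. circle_norm L (\<lambda>y. h y - clip (real (Suc n)) (h y)) < e"
    using e by (rule order_tendstoD)
  then obtain n where "circle_norm L (\<lambda>y. h y - clip (real (Suc n)) (h y)) < e"
    by (auto simp: eventually_sequentially)
  then show ?thesis
    using that[of "real (Suc n)"] by simp
qed

text \<open>Lebesgue measurability supplies continuous functions converging to \<open>h\<close> off
  a negligible set, but no bound on them. Clipping them at the same level R gives a constant
  dominating function and keeps the pointwise convergence.\<close>

lemma circle_clip_approx_continuous:
  assumes L: "L > 0" and h: "h \<in> borel_measurable (circle_measure L)" and R: "R > 0" and e: "e > 0"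
  obtains f where "continuous_on UNIV f" "f 0 = f L" "circle_norm L (\<lambda>y. clip R (h y) - f y) < e"
proof -
  have "h measurable_on {0..<L}"
    using h by (simp add: measurable_on_iff_borel_measurable)
  then obtain N g where N: "negligible N" and g: "\<And>n. continuous_on UNIV (g n)"
    and lim: "\<And>x. x \<notin> N \<Longrightarrow> (\<lambda>n::nat. g n x) \<longlonglongrightarrow> (if x \<in> {0..<L} then h x else 0)"
    unfolding measurable_on_def by blast
  \<comment> \<open>The first factor vanishes at 0 and at \<open>L\<close>, which forces equal
    endpoint values, and it tends to 1 at every interior point.\<close>
  define f where "f = (\<lambda>n y. complex_of_real (min 1 (real n * \<bar>y * (L - y)\<bar>)) * clip R (g n y))"
  have cg: "continuous_on UNIV (\<lambda>y. clip R (g n y))" for n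
    by (rule continuous_on_compose2[OF continuous_clip[OF R] g]) simp
  have f: "continuous_on UNIV (f n)" for n
    unfolding f_def by (intro continuous_intros cg)
  have f_le: "cmod (f n y) \<le> 1 * R" for n y
    unfolding f_def norm_mult using cmod_clip_le[OF R] R by (intro mult_mono) auto
  have "(\<lambda>n. circle_norm L (\<lambda>y. clip R (h y) - f n y)) \<longlonglongrightarrow> 0"
  proof (rule circle_norm_tendsto_0)
    show "(\<lambda>y. clip R (h y) - f n y) \<in> borel_measurable (circle_measure L)" for n
      using measurable_clip[OF R h] measurable_continuous_circle[OF f] by (intro borel_measurable_diff)
    \<comment> \<open>The point 0 is excluded too, since the factor in \<open>f\<close> is 0 there
      for every \<open>n\<close>; the other endpoint does not belong to {0..<L}.\<close>
    have "insert 0 N \<in> null_sets lebesgue"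
      using N by (simp add: negligible_iff_null_sets[symmetric])
    then have "AE y in lebesgue. y \<notin> insert 0 N"
      by (rule AE_not_in)
    then have "AE y in circle_measure L. y \<notin> insert 0 N"
      by (subst AE_restrict_space_iff) (auto elim: eventually_mono)
    moreover have "AE y in circle_measure L. y \<in> {0..<L}"
      by (rule AE_I2) simp
    ultimately show "AE y in circle_measure L. (\<lambda>n. clip R (h y) - f n y) \<longlonglongrightarrow> 0"
    proof eventually_elim
      case (elim y)
      then have pos: "\<bar>y * (L - y)\<bar> > 0"
        by auto
      have "(\<lambda>n. min 1 (real n * \<bar>y * (L - y)\<bar>)) \<longlonglongrightarrow> 1"
      proof (rule tendsto_eventually)
        obtain n0 :: nat where n0: "1 < real n0 * \<bar>y * (L - y)\<bar>"
          using reals_Archimedean3[OF pos] by blast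
        show "\<forall>\<^sub>F n in sequentially. min 1 (real n * \<bar>y * (L - y)\<bar>) = 1"
          using eventually_ge_at_top[of n0]
        proof eventually_elim
          case (elim n)
          then have "real n0 * \<bar>y * (L - y)\<bar> \<le> real n * \<bar>y * (L - y)\<bar>"
            by (intro mult_right_mono) auto
          then show ?case
            using n0 by simp
        qed
      qed
      moreover have "(\<lambda>n. clip R (g n y)) \<longlonglongrightarrow> clip R (h y)"
      proof -
        have "isCont (clip R) (h y)"
          using continuous_clip[OF R] by (simp add: continuous_on_eq_continuous_at)
        moreover have "(\<lambda>n. g n y) \<longlonglongrightarrow> h y"
          using lim[of y] elim by simp
        ultimately show ?thesis
          by (rule isCont_tendsto_compose)
      qed
      ultimately have "(\<lambda>n. f n y) \<longlonglongrightarrow> complex_of_real 1 * clip R (h y)"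
        unfolding f_def by (intro tendsto_intros)
      from tendsto_diff[OF tendsto_const[of "clip R (h y)"] this] show ?case
        by simp
    qed
    show "integrable (circle_measure L) (\<lambda>y. (2 * R)\<^sup>2)"
      by (intro integrable_continuous_circle continuous_intros)
    show "cmod (clip R (h y) - f n y) \<le> 2 * R" for n y
      using norm_triangle_ineq4[of "clip R (h y)" "f n y"] cmod_clip_le[OF R, of "h y"] f_le[of n y] by simp
  qed
  then have "\<forall>\<^sub>F n in sequentially. circle_norm L (\<lambda>y. clip R (h y) - f n y) < e"
    using e by (rule order_tendstoD)
  then obtain n where "circle_norm L (\<lambda>y. clip R (h y) - f n y) < e"
    by (auto simp: eventually_sequentially)
  then show ?thesis
    by (intro that[of "f n"] f) (auto simp: f_def)
qed

lemma trig_poly_dense_circle_L2: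
  assumes L: "L > 0" and h: "h \<in> circle_L2 L" and e: "e > 0"
  obtains p where "trig_poly L p" "circle_norm L (\<lambda>y. h y - p y) < e"
proof -
  obtain R where R: "R > 0" "circle_norm L (\<lambda>y. h y - clip R (h y)) < e / 3"
    using circle_L2_approx_clip[OF h, of "e / 3"] e by auto
  obtain f where f: "continuous_on UNIV f" "f 0 = f L" "circle_norm L (\<lambda>y. clip R (h y) - f y) < e / 3"
    using circle_clip_approx_continuous[OF L circle_L2_measurable[OF h] R(1), of "e / 3"] e by auto
  \<comment> \<open>A uniform error \<open>d\<close> is an L^2 error of at most \<open>d\<close>
    times the norm of 1; the added 1 keeps the quotient defined and the estimate strict.\<close>
  define d where "d = e / 3 / (circle_norm L (\<lambda>_. 1) + 1)"
  have one: "circle_norm L (\<lambda>_. 1) + 1 > 0"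
    by (simp add: add_nonneg_pos)
  have d: "d > 0"
    using e one by (simp add: d_def)
  obtain p where p: "trig_poly L p" "\<And>y. y \<in> {0..L} \<Longrightarrow> cmod (f y - p y) < d"
    using trig_poly_dense_continuous[OF L continuous_on_subset[OF f(1)] f(2) d] by auto
  have c: "continuous_on UNIV (\<lambda>y. f y - p y)"
    by (intro continuous_intros f continuous_trig_poly[OF p(1)])
  have "circle_norm L (\<lambda>y. (f y - p y) * 1) \<le> d * circle_norm L (\<lambda>_. 1)"
    using p(2) d
    by (intro circle_norm_mult_bounded circle_L2_continuous measurable_continuous_circle c continuous_intros)
      (auto intro: less_imp_le)
  also have "\<dots> < d * (circle_norm L (\<lambda>_. 1) + 1)"
    using d by simp
  also have "\<dots> = e / 3"
    unfolding d_def using one by (intro nonzero_divide_eq_eq[THEN iffD1, symmetric] nonzero_eq_divide_eq[THEN iffD1]) auto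
  finally have fp: "circle_norm L (\<lambda>y. f y - p y) < e / 3"
    by simp
  have hc: "(\<lambda>y. h y - clip R (h y)) \<in> circle_L2 L" and cf: "(\<lambda>y. clip R (h y) - f y) \<in> circle_L2 L"
    by (intro circle_L2_diff h circle_L2_clip R circle_L2_measurable circle_L2_continuous f)+
  have "circle_norm L (\<lambda>y. (h y - clip R (h y)) + ((clip R (h y) - f y) + (f y - p y)))
      \<le> circle_norm L (\<lambda>y. h y - clip R (h y)) + circle_norm L (\<lambda>y. (clip R (h y) - f y) + (f y - p y))"
    by (intro circle_norm_triangle hc circle_L2_add cf circle_L2_continuous c)
  also have "circle_norm L (\<lambda>y. (clip R (h y) - f y) + (f y - p y))
      \<le> circle_norm L (\<lambda>y. clip R (h y) - f y) + circle_norm L (\<lambda>y. f y - p y)"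
    by (intro circle_norm_triangle cf circle_L2_continuous c)
  finally have "circle_norm L (\<lambda>y. h y - p y) < e"
    using R(2) f(3) fp by simp
  with p(1) show ?thesis
    by (rule that)
qed

lemma fourier_sum_tendsto:
  assumes L: "L > 0" and h: "h \<in> circle_L2 L"
  shows "(\<lambda>M. circle_norm L (\<lambda>y. h y - fourier_sum L h M y)) \<longlonglongrightarrow> 0"
proof (rule LIMSEQ_I)
  fix e :: real assume "e > 0"
  then obtain p where p: "trig_poly L p" "circle_norm L (\<lambda>y. h y - p y) < e"
    using trig_poly_dense_circle_L2[OF L h] by blast
  obtain M a where M: "\<And>M' y. M' \<ge> M \<Longrightarrow> p y = (\<Sum>n\<in>{- int M'..int M'}. a n * fourier_mode L n y)"
    using trig_poly_coeffs[OF p(1)] by blast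
  have "circle_norm L (\<lambda>y. h y - fourier_sum L h M' y) < e" if "M' \<ge> M" for M'
    using fourier_sum_best_approximation[OF L h, of M' a] p(2) by (simp flip: M[OF that])
  then show "\<exists>M. \<forall>M'\<ge>M. norm (circle_norm L (\<lambda>y. h y - fourier_sum L h M' y) - 0) < e"
    by auto
qed

section \<open>Fourier coefficients of weak derivatives\<close>

lemma deriv_funpow_cos:
  "(deriv ^^ j) (\<lambda>x. cos (c * x + d)) = (\<lambda>x::real. c ^ j * cos (c * x + d + real j * (pi / 2)))"
proof (induction j)
  case (Suc j)
  have "deriv (\<lambda>x. c ^ j * cos (c * x + d + real j * (pi / 2))) x
      = c ^ Suc j * cos (c * x + d + real (Suc j) * (pi / 2))" for x
  proof (rule DERIV_imp_deriv)
    have "cos (c * x + d + real (Suc j) * (pi / 2)) = cos ((c * x + d + real j * (pi / 2)) + pi / 2)"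
      by (simp add: algebra_simps add_divide_distrib)
    also have "\<dots> = - sin (c * x + d + real j * (pi / 2))"
      by (simp add: cos_add)
    finally show "((\<lambda>x. c ^ j * cos (c * x + d + real j * (pi / 2))) has_real_derivative
        c ^ Suc j * cos (c * x + d + real (Suc j) * (pi / 2))) (at x)"
      by (auto intro!: derivative_eq_intros)
  qed
  then show ?case
    unfolding funpow.simps o_apply Suc.IH by (rule ext)
qed simp

lemma smooth_periodic_cos:
  assumes "c * L = 2 * pi * of_int n"
  shows "smooth_periodic L (\<lambda>x. cos (c * x + d))"
proof -
  have "(\<lambda>x. c ^ j * cos (c * x + d + real j * (pi / 2))) differentiable (at x)" for j x
    unfolding real_differentiable_def by (rule exI) (auto intro!: derivative_eq_intros)
  moreover have "cos (c * (x + L) + d) = cos (c * x + d)" for x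
  proof -
    have "c * (x + L) + d = (c * x + d) + 2 * pi * of_int n"
      using assms by (simp add: algebra_simps)
    then show ?thesis
      by (simp only: cos_add cos_int_2pin sin_int_2pin) simp
  qed
  ultimately show ?thesis
    by (simp add: smooth_periodic_def deriv_funpow_cos)
qed

text \<open>Test functions are real, so the mode is split into cosines with phases 0 and -pi/2, the
  second being the sine. Keeping the phase as a parameter treats both parts with one computation, as
  the second derivative only multiplies by -w^2.\<close>

lemma fourier_coeff_weak_deriv_2:
  assumes L: "L > 0" and gh: "has_weak_deriv L 2 g h"
  shows "fourier_coeff L h n = - (complex_of_real (2 * pi * of_int n / L))\<^sup>2 * fourier_coeff L g n"
proof -
  let ?M = "circle_measure L"
  define w where "w = 2 * pi * of_int n / L"
  have gL2: "g \<in> circle_L2 L" and hL2: "h \<in> circle_L2 L"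
    using gh by (auto simp: has_weak_deriv_def)
  define \<phi> where "\<phi> = (\<lambda>d x. cos (w * x + d))"
  have int: "(\<integral>y. h y * complex_of_real (\<phi> d y) \<partial>?M)
      = - (complex_of_real w)\<^sup>2 * (\<integral>y. g y * complex_of_real (\<phi> d y) \<partial>?M)" for d
  proof -
    have "smooth_periodic L (\<phi> d)"
      unfolding \<phi>_def using L by (intro smooth_periodic_cos[of _ _ n]) (simp add: w_def)
    then have "(\<integral>y. h y * complex_of_real (\<phi> d y) \<partial>?M) = (\<integral>y. g y * complex_of_real ((deriv ^^ 2) (\<phi> d) y) \<partial>?M)"
      using gh by (simp add: has_weak_deriv_def)
    also have "(deriv ^^ 2) (\<phi> d) = (\<lambda>y. - w\<^sup>2 * \<phi> d y)"
      unfolding \<phi>_def deriv_funpow_cos by simp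
    also have "(\<integral>y. g y * complex_of_real (- w\<^sup>2 * \<phi> d y) \<partial>?M)
        = (\<integral>y. - (complex_of_real w)\<^sup>2 * (g y * complex_of_real (\<phi> d y)) \<partial>?M)"
      by (intro Bochner_Integration.integral_cong) auto
    finally show ?thesis by simp
  qed
  have mode: "fourier_mode L (- n) y = complex_of_real (\<phi> 0 y) + (- \<i>) * complex_of_real (\<phi> (- (pi / 2)) y)" for y
    by (simp add: complex_eq_iff fourier_mode_def \<phi>_def w_def cos_add)
  have c\<phi>: "continuous_on UNIV (\<lambda>y. complex_of_real (\<phi> d y))" for d
    unfolding \<phi>_def by (intro continuous_intros)
  have split: "(\<integral>y. f y * fourier_mode L (- n) y \<partial>?M)
      = (\<integral>y. f y * complex_of_real (\<phi> 0 y) \<partial>?M) + (- \<i>) * (\<integral>y. f y * complex_of_real (\<phi> (- (pi / 2)) y) \<partial>?M)"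
    if f: "f \<in> circle_L2 L" for f
  proof -
    have i: "integrable ?M (\<lambda>y. f y * complex_of_real (\<phi> d y))" for d
      by (intro circle_L2_mult_integrable f circle_L2_continuous c\<phi>)
    have "(\<integral>y. f y * fourier_mode L (- n) y \<partial>?M)
        = (\<integral>y. f y * complex_of_real (\<phi> 0 y) + (- \<i>) * (f y * complex_of_real (\<phi> (- (pi / 2)) y)) \<partial>?M)"
      by (simp add: mode algebra_simps)
    also have "\<dots> = (\<integral>y. f y * complex_of_real (\<phi> 0 y) \<partial>?M) + (\<integral>y. (- \<i>) * (f y * complex_of_real (\<phi> (- (pi / 2)) y)) \<partial>?M)"
      by (intro Bochner_Integration.integral_add i Bochner_Integration.integrable_mult_right)
    finally show ?thesis by simp
  qed
  show ?thesis
    unfolding fourier_coeff_def split[OF hL2] split[OF gL2] int w_def[symmetric] by (simp add: algebra_simps)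
qed

lemma fourier_coeff_lincomb:
  assumes "f \<in> circle_L2 L" "g \<in> circle_L2 L"
  shows "fourier_coeff L (\<lambda>y. c * f y + g y) n = c * fourier_coeff L f n + fourier_coeff L g n"
proof -
  have "(\<integral>y. (c * f y + g y) * fourier_mode L (- n) y \<partial>circle_measure L)
      = (\<integral>y. c * (f y * fourier_mode L (- n) y) + g y * fourier_mode L (- n) y \<partial>circle_measure L)"
    by (simp add: algebra_simps)
  also have "\<dots> = c * (\<integral>y. f y * fourier_mode L (- n) y \<partial>circle_measure L)
      + (\<integral>y. g y * fourier_mode L (- n) y \<partial>circle_measure L)"
    using circle_L2_mult_integrable[OF assms(1) circle_L2_fourier_mode]
      circle_L2_mult_integrable[OF assms(2) circle_L2_fourier_mode] by simp
  finally show ?thesis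
    by (simp add: fourier_coeff_def add_divide_distrib)
qed

section \<open>Weak derivatives\<close>

lemma smooth_periodic_DERIV:
  assumes "smooth_periodic L \<phi>"
  shows "((deriv ^^ j) \<phi> has_real_derivative (deriv ^^ Suc j) \<phi> x) (at x)"
proof -
  have "(deriv ^^ j) \<phi> differentiable (at x)"
    using assms by (simp add: smooth_periodic_def)
  then show ?thesis
    by (simp add: DERIV_deriv_iff_real_differentiable)
qed

lemma smooth_periodic_continuous:
  "smooth_periodic L \<phi> \<Longrightarrow> continuous_on UNIV ((deriv ^^ j) \<phi>)"
  by (intro continuous_at_imp_continuous_on ballI DERIV_isCont[OF smooth_periodic_DERIV])

lemma smooth_periodic_deriv_periodic:
  assumes "smooth_periodic L \<phi>"
  shows "(deriv ^^ j) \<phi> (x + L) = (deriv ^^ j) \<phi> x"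
proof (induction j arbitrary: x)
  case 0
  then show ?case
    using assms by (simp add: smooth_periodic_def)
next
  case (Suc j)
  have "((\<lambda>x. (deriv ^^ j) \<phi> (x + L)) has_real_derivative (deriv ^^ Suc j) \<phi> (x + L)) (at x)"
    using smooth_periodic_DERIV[OF assms] by (subst DERIV_shift[symmetric])
  then have "((deriv ^^ j) \<phi> has_real_derivative (deriv ^^ Suc j) \<phi> (x + L)) (at x)"
    by (simp only: Suc.IH)
  then show ?case
    using smooth_periodic_DERIV[OF assms] by (rule DERIV_unique)
qed

lemma smooth_periodic_deriv:
  assumes "smooth_periodic L \<phi>"
  shows "smooth_periodic L ((deriv ^^ j) \<phi>)"
proof -
  have "(deriv ^^ n) ((deriv ^^ j) \<phi>) = (deriv ^^ (n + j)) \<phi>" for n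
    by (simp add: funpow_add)
  then show ?thesis
    using assms smooth_periodic_deriv_periodic[OF assms] unfolding smooth_periodic_def by metis
qed

lemma circle_L2_smooth_periodic:
  "smooth_periodic L \<phi> \<Longrightarrow> (\<lambda>y. complex_of_real ((deriv ^^ j) \<phi> y)) \<in> circle_L2 L"
  by (intro circle_L2_continuous continuous_on_of_real smooth_periodic_continuous)

lemma has_weak_deriv_lincomb:
  assumes f: "has_weak_deriv L j f f'" and g: "has_weak_deriv L j g g'"
  shows "has_weak_deriv L j (\<lambda>y. c * f y + g y) (\<lambda>y. c * f' y + g' y)"
proof -
  have L2: "f \<in> circle_L2 L" "f' \<in> circle_L2 L" "g \<in> circle_L2 L" "g' \<in> circle_L2 L"
    using f g by (auto simp: has_weak_deriv_def)
  have lin: "(\<integral>y. (c * p y + q y) * complex_of_real ((deriv ^^ i) \<phi> y) \<partial>circle_measure L)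
      = c * (\<integral>y. p y * complex_of_real ((deriv ^^ i) \<phi> y) \<partial>circle_measure L)
        + (\<integral>y. q y * complex_of_real ((deriv ^^ i) \<phi> y) \<partial>circle_measure L)"
    if "p \<in> circle_L2 L" "q \<in> circle_L2 L" "smooth_periodic L \<phi>" for p q \<phi> i
  proof -
    note int = circle_L2_mult_integrable[OF that(1) circle_L2_smooth_periodic[OF that(3)]]
      circle_L2_mult_integrable[OF that(2) circle_L2_smooth_periodic[OF that(3)]]
    have "(\<integral>y. (c * p y + q y) * complex_of_real ((deriv ^^ i) \<phi> y) \<partial>circle_measure L)
        = (\<integral>y. c * (p y * complex_of_real ((deriv ^^ i) \<phi> y)) + q y * complex_of_real ((deriv ^^ i) \<phi> y) \<partial>circle_measure L)"
      by (simp add: distrib_right mult.assoc)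
    then show ?thesis
      using int[of i] by simp
  qed
  show ?thesis
    unfolding has_weak_deriv_def
  proof (intro conjI allI impI circle_L2_add circle_L2_cmult L2)
    fix \<phi> assume \<phi>: "smooth_periodic L \<phi>"
    have "(\<integral>y. p y * complex_of_real ((deriv ^^ j) \<phi> y) \<partial>circle_measure L)
        = (- 1) ^ j * (\<integral>y. p' y * complex_of_real (\<phi> y) \<partial>circle_measure L)"
      if "has_weak_deriv L j p p'" for p p'
      using that \<phi> by (simp add: has_weak_deriv_def)
    note this[OF f] this[OF g]
    then show "(\<integral>y. (c * f y + g y) * complex_of_real ((deriv ^^ j) \<phi> y) \<partial>circle_measure L)
        = (- 1) ^ j * (\<integral>y. (c * f' y + g' y) * complex_of_real (\<phi> y) \<partial>circle_measure L)"
      using lin[OF L2(1,3) \<phi>, of j] lin[OF L2(2,4) \<phi>, of 0] by (simp add: algebra_simps)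
  qed
qed

text \<open>The second derivative of a test function is again a test function. This reconciles
  \<open>circle_sobolev\<close>, which speaks of derivatives of g alone, with \<open>H_op\<close>,
  which differentiates a weak derivative once more.\<close>

lemma has_weak_deriv_2_of_4:
  assumes "has_weak_deriv L 2 g h" "has_weak_deriv L 4 g f"
  shows "has_weak_deriv L 2 h f"
  unfolding has_weak_deriv_def
proof (intro conjI allI impI)
  fix \<phi> assume \<phi>: "smooth_periodic L \<phi>"
  have eq: "(deriv ^^ 4) \<phi> = (deriv ^^ 2) ((deriv ^^ 2) \<phi>)"
    by (simp add: eval_nat_numeral)
  have "(\<integral>y. h y * complex_of_real ((deriv ^^ 2) \<phi> y) \<partial>circle_measure L)
      = (\<integral>y. g y * complex_of_real ((deriv ^^ 4) \<phi> y) \<partial>circle_measure L)"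
    unfolding eq using assms(1) smooth_periodic_deriv[OF \<phi>, of 2] by (simp add: has_weak_deriv_def)
  also have "\<dots> = (\<integral>y. f y * complex_of_real (\<phi> y) \<partial>circle_measure L)"
    using assms(2) \<phi> by (simp add: has_weak_deriv_def)
  finally show "(\<integral>y. h y * complex_of_real ((deriv ^^ 2) \<phi> y) \<partial>circle_measure L)
      = (- 1)\<^sup>2 * (\<integral>y. f y * complex_of_real (\<phi> y) \<partial>circle_measure L)"
    by simp
qed (use assms in \<open>auto simp: has_weak_deriv_def\<close>)

lemma weak_deriv_ex: "has_weak_deriv L j g h \<Longrightarrow> has_weak_deriv L j g (weak_deriv L j g)"
  unfolding weak_deriv_def by (rule someI[of "has_weak_deriv L j g"])

text \<open>The operator contains two nested choices by \<open>SOME\<close>. On the domain both have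
  a witness, so both chosen functions really are weak derivatives.\<close>

lemma circle_sobolev_weak_deriv:
  assumes g: "g \<in> circle_sobolev L 4"
  shows "has_weak_deriv L 2 g (weak_deriv L 2 g)"
    and "has_weak_deriv L 2 (laplace_k L k g) (weak_deriv L 2 (laplace_k L k g))"
proof -
  obtain f h where fh: "has_weak_deriv L 2 g h" "has_weak_deriv L 4 g f"
    using g unfolding circle_sobolev_def by fastforce
  then show *: "has_weak_deriv L 2 g (weak_deriv L 2 g)"
    by (intro weak_deriv_ex)
  have "has_weak_deriv L 2 (weak_deriv L 2 g) f"
    using * fh(2) by (rule has_weak_deriv_2_of_4)
  from has_weak_deriv_lincomb[OF * this, of "- (complex_of_real k)\<^sup>2"]
  show "has_weak_deriv L 2 (laplace_k L k g) (weak_deriv L 2 (laplace_k L k g))"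
    unfolding laplace_k_def by (rule weak_deriv_ex)
qed

lemma laplace_k_fourier:
  assumes L: "L > 0" and g: "has_weak_deriv L 2 g (weak_deriv L 2 g)"
  shows "laplace_k L k g \<in> circle_L2 L"
    and "fourier_coeff L (laplace_k L k g) n
      = - ((complex_of_real k)\<^sup>2 + (complex_of_real (2 * pi * of_int n / L))\<^sup>2) * fourier_coeff L g n"
proof -
  have L2: "g \<in> circle_L2 L" "weak_deriv L 2 g \<in> circle_L2 L"
    using g by (auto simp: has_weak_deriv_def)
  show "laplace_k L k g \<in> circle_L2 L"
    unfolding laplace_k_def by (intro circle_L2_add circle_L2_cmult L2)
  show "fourier_coeff L (laplace_k L k g) n
      = - ((complex_of_real k)\<^sup>2 + (complex_of_real (2 * pi * of_int n / L))\<^sup>2) * fourier_coeff L g n"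
    unfolding laplace_k_def fourier_coeff_lincomb[OF L2] fourier_coeff_weak_deriv_2[OF L g]
    by (simp only: distrib_right minus_add_distrib)
qed

text \<open>Constants provide the unit vector for \<open>Psi_geI\<close>. That their weak
  derivatives are 0 says that a derivative of a periodic function has mean zero.\<close>

lemma circle_sobolev_const:
  assumes "L \<ge> 0"
  shows "(\<lambda>y. c) \<in> circle_sobolev L s"
proof -
  have "has_weak_deriv L j (\<lambda>y. c) (\<lambda>y. 0)" if j: "j \<ge> 1" for j
    unfolding has_weak_deriv_def
  proof (intro conjI allI impI)
    fix \<phi> assume \<phi>: "smooth_periodic L \<phi>"
    obtain i where i: "j = Suc i"
      using j by (cases j) auto
    have "(\<integral>y. (deriv ^^ j) \<phi> y \<partial>circle_measure L) = (deriv ^^ i) \<phi> L - (deriv ^^ i) \<phi> 0"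
      unfolding i using smooth_periodic_DERIV[OF \<phi>]
      by (intro integral_circle_deriv assms smooth_periodic_continuous[OF \<phi>])
        (simp add: has_real_derivative_iff_has_vector_derivative)
    also have "\<dots> = 0"
      using smooth_periodic_deriv_periodic[OF \<phi>, of i 0] by simp
    finally have "(\<integral>y. (deriv ^^ j) \<phi> y \<partial>circle_measure L) = 0" .
    then show "(\<integral>y. c * complex_of_real ((deriv ^^ j) \<phi> y) \<partial>circle_measure L)
        = (- 1) ^ j * (\<integral>y. 0 * complex_of_real (\<phi> y) \<partial>circle_measure L)"
      by (simp add: integral_complex_of_real)
  qed (auto intro: circle_L2_continuous)
  then have "\<forall>j\<in>{1..s}. \<exists>h. has_weak_deriv L j (\<lambda>y. c) h"
    by (meson atLeastAtMost_iff)
  then show ?thesis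
    by (simp add: circle_sobolev_def circle_L2_continuous)
qed

section \<open>Transfer from trigonometric sums to the Sobolev space\<close>

lemma circle_C4_trig_sum:
  assumes "L > 0"
  shows "circle_C4 L (\<lambda>j y. \<Sum>n\<in>A. a n * (\<i> * complex_of_real (2 * pi * of_int n / L)) ^ j * fourier_mode L n y)"
proof
  fix j :: nat and y
  show "((\<lambda>y. \<Sum>n\<in>A. a n * (\<i> * complex_of_real (2 * pi * of_int n / L)) ^ j * fourier_mode L n y)
      has_vector_derivative
      (\<Sum>n\<in>A. a n * (\<i> * complex_of_real (2 * pi * of_int n / L)) ^ Suc j * fourier_mode L n y)) (at y)"
  proof (rule has_vector_derivative_sum)
    fix n
    show "((\<lambda>y. a n * (\<i> * complex_of_real (2 * pi * of_int n / L)) ^ j * fourier_mode L n y)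
      has_vector_derivative a n * (\<i> * complex_of_real (2 * pi * of_int n / L)) ^ Suc j * fourier_mode L n y) (at y)"
      using has_vector_derivative_mult_right[OF fourier_mode_deriv[of L n y],
          of "a n * (\<i> * complex_of_real (2 * pi * of_int n / L)) ^ j"]
      by (simp only: power_Suc mult_ac)
  qed
next
  fix j :: nat
  have "fourier_mode L n L = fourier_mode L n 0" for n
    using assms by (simp add: fourier_mode_period) (simp add: fourier_mode_def)
  then show "(\<Sum>n\<in>A. a n * (\<i> * complex_of_real (2 * pi * of_int n / L)) ^ j * fourier_mode L n L)
      = (\<Sum>n\<in>A. a n * (\<i> * complex_of_real (2 * pi * of_int n / L)) ^ j * fourier_mode L n 0)"
    by simp
qed (use assms in \<open>auto intro!: continuous_intros continuous_fourier_mode\<close>)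

lemma circle_norm_diff_le:
  assumes "f \<in> circle_L2 L" "g \<in> circle_L2 L"
  shows "circle_norm L f \<le> circle_norm L g + circle_norm L (\<lambda>y. f y - g y)"
  using circle_norm_triangle[OF assms(2) circle_L2_diff[OF assms]] by simp

lemma bounded_continuous_interval:
  fixes u :: "real \<Rightarrow> real"
  assumes "continuous_on UNIV u"
  obtains C where "C \<ge> 0" "\<And>y. y \<in> {0..<L} \<Longrightarrow> \<bar>u y\<bar> \<le> C"
proof -
  have "compact (u ` {0..L})"
    using assms by (intro compact_continuous_image) (auto intro: continuous_on_subset)
  then have "bounded (u ` {0..L})"
    by (rule compact_imp_bounded)
  then obtain C where C: "\<forall>z\<in>u ` {0..L}. norm z \<le> C"
    unfolding bounded_iff by blast
  show ?thesis
    by (rule that[of "max 0 C"]) (use C in \<open>auto simp: le_max_iff_disj\<close>)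
qed

lemma resolvent_bound_circle_sobolev:
  fixes u :: "real \<Rightarrow> real" and b :: real
  assumes L: "L > 0" and u: "continuous_on UNIV u" and k: "k \<noteq> 0"
    and bound: "\<And>g. circle_C4 L g \<Longrightarrow> b * circle_norm L (g 0)
       \<le> circle_norm L (\<lambda>y. complex_of_real \<nu> *
            (- (complex_of_real k)\<^sup>2 * (- (complex_of_real k)\<^sup>2 * g 0 y + g 2 y)
             + (- (complex_of_real k)\<^sup>2 * g 2 y + g 4 y))
           + \<i> * complex_of_real (k * (u y - lam / k)) * g 0 y)"
    and b: "b \<ge> 0" and g: "g \<in> circle_sobolev L 4"
  shows "b * circle_norm L g \<le> circle_norm L (\<lambda>y. H_op L u \<nu> k g y - \<i> * complex_of_real lam * g y)"
proof -
  define D where "D = laplace_k L k (laplace_k L k g)"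
  \<comment> \<open>Since k is nonzero, \<lambda> is absorbed into the level lam / k:
    \<open>v\<close> is the multiplier i k u - i \<lambda>.\<close>
  define v where "v = (\<lambda>y. \<i> * complex_of_real (k * (u y - lam / k)))"
  define F where "F = (\<lambda>y. complex_of_real \<nu> * D y + v y * g y)"
  have F_eq: "(\<lambda>y. H_op L u \<nu> k g y - \<i> * complex_of_real lam * g y) = F"
    using k by (simp add: fun_eq_iff F_def H_op_def D_def v_def algebra_simps)
  note wd = circle_sobolev_weak_deriv[OF g]
  have gL2: "g \<in> circle_L2 L"
    using g by (simp add: circle_sobolev_def)
  have DL2: "D \<in> circle_L2 L"
    unfolding D_def by (rule laplace_k_fourier[OF L wd(2)])
  have coeff_D: "fourier_coeff L D n
      = ((complex_of_real k)\<^sup>2 + (complex_of_real (2 * pi * of_int n / L))\<^sup>2)\<^sup>2 * fourier_coeff L g n" for n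
    unfolding D_def laplace_k_fourier(2)[OF L wd(2)] laplace_k_fourier(2)[OF L wd(1)]
    by (simp only: power2_eq_square mult_minus_left mult_minus_right minus_minus mult.assoc)
  have cv: "continuous_on UNIV v"
    unfolding v_def by (intro continuous_intros u)
  have "continuous_on UNIV (\<lambda>y. k * (u y - lam / k))"
    by (intro continuous_intros u)
  then obtain C where C: "C \<ge> 0" "\<And>y. y \<in> {0..<L} \<Longrightarrow> \<bar>k * (u y - lam / k)\<bar> \<le> C"
    using bounded_continuous_interval by blast
  have v_le: "cmod (v y) \<le> C" if "y \<in> {0..<L}" for y
    using C(2)[OF that] by (simp add: v_def norm_mult del: of_real_mult of_real_diff)
  have FL2: "F \<in> circle_L2 L"
    unfolding F_def by (intro circle_L2_add circle_L2_cmult DL2 circle_L2_mult_continuous gL2 cv)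
  define S where "S = fourier_sum L"
  have SL2: "S h M \<in> circle_L2 L" for h M
    unfolding S_def by (rule circle_L2_fourier_sum)
  \<comment> \<open>Multiplication by \<open>v\<close> does not commute with partial sums. It is
    therefore applied to the partial sum of \<open>g\<close>, and the error is bounded by the
    supremum \<open>C\<close> of |v|; only the diffusion part is itself a partial sum.\<close>
  have step: "b * (circle_norm L g - circle_norm L (\<lambda>y. g y - S g M y))
      \<le> circle_norm L F + (cmod (complex_of_real \<nu>) * circle_norm L (\<lambda>y. D y - S D M y)
           + C * circle_norm L (\<lambda>y. g y - S g M y))" for M
  proof -
    define q where "q = (\<lambda>j y. \<Sum>n\<in>{- int M..int M}.
        fourier_coeff L g n * (\<i> * complex_of_real (2 * pi * of_int n / L)) ^ j * fourier_mode L n y)"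
    have q: "circle_C4 L q"
      unfolding q_def using L by (rule circle_C4_trig_sum)
    have q0: "q 0 = S g M"
      by (simp add: fun_eq_iff q_def S_def fourier_sum_def)
    have qD: "- (complex_of_real k)\<^sup>2 * (- (complex_of_real k)\<^sup>2 * q 0 y + q 2 y)
             + (- (complex_of_real k)\<^sup>2 * q 2 y + q 4 y) = S D M y" for y
    proof -
      \<comment> \<open>One summand of the claim, with k^2 for \<open>K\<close> and 2 pi n / L for
        \<open>w\<close>: applying the symbol -(K + w^2) twice. The power 0 is kept to match the
        unfolded \<open>q 0\<close>.\<close>
      have "- K * (- K * (c * (\<i> * w) ^ 0 * e) + c * (\<i> * w) ^ 2 * e) + (- K * (c * (\<i> * w) ^ 2 * e) + c * (\<i> * w) ^ 4 * e)
          = (K + w\<^sup>2)\<^sup>2 * c * e" for K c w e :: complex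
        by (simp add: power_mult_distrib power2_eq_square power4_eq_xxxx algebra_simps)
      then show ?thesis
        unfolding q_def S_def fourier_sum_def coeff_D
        by (simp only: sum_distrib_left sum.distrib[symmetric])
    qed
    have FM: "(\<lambda>y. complex_of_real \<nu> * S D M y + v y * S g M y) \<in> circle_L2 L"
      by (intro circle_L2_add circle_L2_cmult SL2 circle_L2_mult_continuous cv)
    have gM: "(\<lambda>y. g y - S g M y) \<in> circle_L2 L" and DM: "(\<lambda>y. D y - S D M y) \<in> circle_L2 L"
      by (intro circle_L2_diff gL2 DL2 SL2)+
    have "b * (circle_norm L g - circle_norm L (\<lambda>y. g y - S g M y)) \<le> b * circle_norm L (S g M)"
      using circle_norm_diff_le[OF gL2 SL2[of g M]] b by (intro mult_left_mono) auto
    also have "\<dots> \<le> circle_norm L (\<lambda>y. complex_of_real \<nu> * S D M y + v y * S g M y)"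
      using bound[OF q, unfolded qD] unfolding q0 v_def .
    also have "\<dots> \<le> circle_norm L F
        + circle_norm L (\<lambda>y. (complex_of_real \<nu> * S D M y + v y * S g M y) - F y)"
      by (intro circle_norm_diff_le FM FL2)
    also have "circle_norm L (\<lambda>y. (complex_of_real \<nu> * S D M y + v y * S g M y) - F y)
        = circle_norm L (\<lambda>y. F y - (complex_of_real \<nu> * S D M y + v y * S g M y))"
      by (rule circle_norm_diff_commute)
    also have "(\<lambda>y. F y - (complex_of_real \<nu> * S D M y + v y * S g M y))
        = (\<lambda>y. complex_of_real \<nu> * (D y - S D M y) + v y * (g y - S g M y))"
      by (simp add: fun_eq_iff F_def algebra_simps)
    also have "circle_norm L \<dots> \<le> circle_norm L (\<lambda>y. complex_of_real \<nu> * (D y - S D M y))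
        + circle_norm L (\<lambda>y. v y * (g y - S g M y))"
      by (intro circle_norm_triangle circle_L2_cmult DM circle_L2_mult_continuous gM cv)
    also have "\<dots> \<le> cmod (complex_of_real \<nu>) * circle_norm L (\<lambda>y. D y - S D M y)
        + C * circle_norm L (\<lambda>y. g y - S g M y)"
      unfolding circle_norm_cmult
      by (intro add_left_mono circle_norm_mult_bounded gM measurable_continuous_circle cv v_le C(1))
    finally show ?thesis by simp
  qed
  have lim: "(\<lambda>M. circle_norm L (\<lambda>y. g y - S g M y)) \<longlonglongrightarrow> 0" "(\<lambda>M. circle_norm L (\<lambda>y. D y - S D M y)) \<longlonglongrightarrow> 0"
    unfolding S_def by (rule fourier_sum_tendsto[OF L gL2], rule fourier_sum_tendsto[OF L DL2])
  have "b * (circle_norm L g - 0) \<le> circle_norm L F + (cmod (complex_of_real \<nu>) * 0 + C * 0)"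
  proof (rule LIMSEQ_le)
    show "(\<lambda>M. b * (circle_norm L g - circle_norm L (\<lambda>y. g y - S g M y))) \<longlonglongrightarrow> b * (circle_norm L g - 0)"
      by (intro tendsto_intros lim)
    show "(\<lambda>M. circle_norm L F + (cmod (complex_of_real \<nu>) * circle_norm L (\<lambda>y. D y - S D M y)
           + C * circle_norm L (\<lambda>y. g y - S g M y))) \<longlonglongrightarrow> circle_norm L F + (cmod (complex_of_real \<nu>) * 0 + C * 0)"
      by (intro tendsto_intros lim)
  qed (use step in blast)
  then show ?thesis
    unfolding F_eq by simp
qed

text \<open>On the reals a common lower bound passes to \<open>Inf\<close> only for a nonempty set;
  the constant 1 / sqrt L is a unit vector of the domain and supplies a member.\<close>

lemma Psi_geI:
  assumes "L > 0" and "\<And>g lam. g \<in> circle_sobolev L s \<Longrightarrow> circle_norm L g = 1 \<Longrightarrow>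
      b \<le> circle_norm L (\<lambda>y. H g y - \<i> * complex_of_real lam * g y)"
  shows "b \<le> Psi L (circle_sobolev L s) H"
proof -
  have "circle_norm L (\<lambda>y. complex_of_real (1 / sqrt L)) = 1"
    using assms(1) by (simp add: circle_norm_def measure_restrict_space norm_divide power_divide)
  moreover have "(\<lambda>y. complex_of_real (1 / sqrt L)) \<in> circle_sobolev L s"
    using assms(1) by (intro circle_sobolev_const) simp
  ultimately show ?thesis
    unfolding Psi_def using assms(2) by (intro cInf_greatest) blast+
qed

theorem proposition3p1:
  fixes L1 L2 c1 \<delta>0 :: real and u :: "real \<Rightarrow> real" and m N :: nat
  assumes "L1 > 0" and "L2 > 0"
    and "smooth_periodic L2 u"
    and "c1 > 0" and "\<delta>0 \<in> {0<..<L2}"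
    and "\<forall>lam::real. \<forall>\<delta>\<in>{0<..<\<delta>0}. \<exists>n\<le>N. \<exists>p :: nat \<Rightarrow> real.
           (\<forall>j\<in>{1..n}. p j \<in> {0..<L2}) \<and>
           (\<forall>y\<in>{0..<L2}. (\<forall>j\<in>{1..n}. circle_dist L2 y (p j) \<ge> \<delta>) \<longrightarrow>
              \<bar>u y - lam\<bar> \<ge> c1 * (\<delta> / L2) ^ m)"
  shows "\<exists>\<epsilon>>0. \<forall>\<nu>\<in>{0<..1}. \<forall>k::real.
           k \<noteq> 0 \<longrightarrow> L1 * k / (2 * pi) \<in> \<int> \<longrightarrow> \<nu> * inverse \<bar>k\<bar> \<le> 1 \<longrightarrow>
           Psi L2 (circle_sobolev L2 4) (H_op L2 u \<nu> k)
             \<ge> \<epsilon> * \<nu> powr (real m / (real m + 4)) * \<bar>k\<bar> powr (4 / (real m + 4))"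
proof -
  have cont: "isCont u y" and per: "u (y + L2) = u y" for y
    using smooth_periodic_DERIV[OF assms(3), of 0 y, THEN DERIV_isCont]
      smooth_periodic_deriv_periodic[OF assms(3), of 0 y] by simp_all
  have \<delta>0: "\<delta>0 > 0"
    using assms(5) by simp
  obtain \<epsilon> where \<epsilon>: "\<epsilon> > 0" and bound: "\<And>\<nu> k l g. 0 < \<nu> \<Longrightarrow> k \<noteq> 0 \<Longrightarrow> \<nu> * inverse \<bar>k\<bar> \<le> 1 \<Longrightarrow> circle_C4 L2 g \<Longrightarrow>
      \<epsilon> * \<nu> powr (real m / (real m + 4)) * \<bar>k\<bar> powr (4 / (real m + 4)) * circle_norm L2 (g 0)
       \<le> circle_norm L2 (\<lambda>y. complex_of_real \<nu> *
            (- (complex_of_real k)\<^sup>2 * (- (complex_of_real k)\<^sup>2 * g 0 y + g 2 y)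
             + (- (complex_of_real k)\<^sup>2 * g 2 y + g 4 y))
           + \<i> * complex_of_real (k * (u y - l)) * g 0 y)"
    using resolvent_bound_C4[OF assms(2,4) \<delta>0 cont per assms(6)] by blast
  show ?thesis
  proof (intro exI[of _ \<epsilon>] conjI ballI allI impI \<epsilon>)
    fix \<nu> k :: real
    assume \<nu>: "\<nu> \<in> {0<..1}" and k: "k \<noteq> 0" "\<nu> * inverse \<bar>k\<bar> \<le> 1"
    let ?b = "\<epsilon> * \<nu> powr (real m / (real m + 4)) * \<bar>k\<bar> powr (4 / (real m + 4))"
    show "Psi L2 (circle_sobolev L2 4) (H_op L2 u \<nu> k) \<ge> ?b"
    proof (rule Psi_geI[OF assms(2)])
      fix g lam assume g: "g \<in> circle_sobolev L2 4" and g1: "circle_norm L2 g = 1"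
      have "?b * circle_norm L2 g \<le> circle_norm L2 (\<lambda>y. H_op L2 u \<nu> k g y - \<i> * complex_of_real lam * g y)"
      \<comment> \<open>The free level \<open>l\<close> of \<open>bound\<close> is instantiated with
        lam / k, so one \<epsilon> serves all real \<open>lam\<close>.\<close>
      proof (rule resolvent_bound_circle_sobolev[OF assms(2) _ k(1) _ _ g])
        show "continuous_on UNIV u"
          using cont by (simp add: continuous_at_imp_continuous_on)
        show "?b \<ge> 0"
          using \<epsilon> by simp
      qed (rule bound; use \<nu> k in simp)
      then show "?b \<le> circle_norm L2 (\<lambda>y. H_op L2 u \<nu> k g y - \<i> * complex_of_real lam * g y)"
        using g1 by simp
    qed
  qed
qed

end
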